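(* Let $p>2$ be a prime and let $G$ be a finite $p$-group of nilpotency class $c$. Let $d$ be the largest integer such that $\exp(\gamma_d(G))=\exp(G)$. If $d\geq c-5$, then $G$ is a $J$-group and $\mathcal{B}(\gamma_d(G))\subseteq\mathcal{W}(G)$.
   Context: A group $G$ is a $J$-group if there exist an element $k\in G$ and a function $f\colon G\to G$ with $f(xk)=xf(x)$ for all $x\in G$. An element $k\in G$ of finite order $n=|k|$ is a witness for $G$ if $\prod_{i=1}^{n} xk^{n-i}=1$ for all $x\in G$, where the product is taken in order of increasing $i$ from left to right, i.e. it equals $xk^{n-1}xk^{n-2}\cdots xk^2\,xk\,x$. $\mathcal{W}(G)$ denotes the set of all witnesses for $G$. The exponent is $\exp(G)=\mathrm{lcm}\{|g| : g\in G\}$, and $\mathcal{B}(G)=\{x\in G : |x|=\exp(G)\}$ (for a subgroup $H$, $\mathcal{B}(H)$ is defined with respect to $\exp(H)$). The lower central series is $\gamma_1(G)=G$, $\gamma_{i+1}(G)=[\gamma_i(G),G]$; the nilpotency class is the least $c\ge 0$ with $\gamma_{c+1}(G)=1$. If $G$ is trivial, so that no largest $d$ exists, $d$ is taken to be $1$. *)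

theory Defs
  imports "HOL-Algebra.Algebra"
begin

text \<open>Subgroups \<open>H\<close> of \<open>G\<close> are treated as groups in their own right through the record
  \<open>G\<lparr>carrier := H\<rparr>\<close>. All definitions are meant for \<open>G\<close> a group.\<close>

definition J_group :: "('a, 'b) monoid_scheme \<Rightarrow> bool" where
  "J_group G \<longleftrightarrow> group G \<and>
     (\<exists>k \<in> carrier G. \<exists>f \<in> carrier G \<rightarrow> carrier G.
        \<forall>x \<in> carrier G. f (x \<otimes>\<^bsub>G\<^esub> k) = x \<otimes>\<^bsub>G\<^esub> f x)"

text \<open>Library orders are \<open>0\<close> for elements of infinite order. The list product is
  \<open>x k\<^sup>n\<^sup>-\<^sup>1 x k\<^sup>n\<^sup>-\<^sup>2 \<dots> x k x\<close>, for \<open>n\<close> the order of \<open>k\<close>.\<close>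

definition witnesses :: "('a, 'b) monoid_scheme \<Rightarrow> 'a set" where
  "witnesses G = {k \<in> carrier G. group.ord G k > 0 \<and>
     (\<forall>x \<in> carrier G.
        foldr (\<otimes>\<^bsub>G\<^esub>)
          (map (\<lambda>i. x \<otimes>\<^bsub>G\<^esub> k [^]\<^bsub>G\<^esub> (group.ord G k - i)) [1..<Suc (group.ord G k)])
          \<one>\<^bsub>G\<^esub> = \<one>\<^bsub>G\<^esub>)}"

definition group_exponent :: "('a, 'b) monoid_scheme \<Rightarrow> nat" where
  "group_exponent G = Lcm (group.ord G ` carrier G)"

definition max_order_elements :: "('a, 'b) monoid_scheme \<Rightarrow> 'a set" where
  "max_order_elements G = {x \<in> carrier G. group.ord G x = group_exponent G}"

definition commutator_subgroup :: "('a, 'b) monoid_scheme \<Rightarrow> 'a set \<Rightarrow> 'a set \<Rightarrow> 'a set" where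
  "commutator_subgroup G H K =
     generate G (\<Union>h \<in> H. \<Union>k \<in> K. {h \<otimes>\<^bsub>G\<^esub> k \<otimes>\<^bsub>G\<^esub> inv\<^bsub>G\<^esub> h \<otimes>\<^bsub>G\<^esub> inv\<^bsub>G\<^esub> k})"

text \<open>The series is indexed from \<open>1\<close>, so \<open>lower_central G 1 = carrier G\<close>;
  the value at index \<open>0\<close> is irrelevant.\<close>

definition lower_central :: "('a, 'b) monoid_scheme \<Rightarrow> nat \<Rightarrow> 'a set" where
  "lower_central G i = ((\<lambda>H. commutator_subgroup G H (carrier G)) ^^ (i - 1)) (carrier G)"

definition has_nilpotency_class :: "('a, 'b) monoid_scheme \<Rightarrow> nat \<Rightarrow> bool" where
  "has_nilpotency_class G c \<longleftrightarrow>
     lower_central G (c + 1) = {\<one>\<^bsub>G\<^esub>} \<and> (\<forall>b < c. lower_central G (b + 1) \<noteq> {\<one>\<^bsub>G\<^esub>})"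

definition finite_p_group :: "nat \<Rightarrow> ('a, 'b) monoid_scheme \<Rightarrow> bool" where
  "finite_p_group p G \<longleftrightarrow> group G \<and> (\<exists>m. order G = p ^ m)"

abbreviation lower_central_group :: "('a, 'b) monoid_scheme \<Rightarrow> nat \<Rightarrow> ('a, 'b) monoid_scheme" where
  "lower_central_group G i \<equiv> G\<lparr>carrier := lower_central G i\<rparr>"

text \<open>\<open>d\<close> is the largest index with \<open>exp(\<gamma>\<^sub>d(G)) = exp(G)\<close>; for trivial \<open>G\<close> every index
  qualifies, and \<open>d = 1\<close> by convention.\<close>

definition last_full_exponent_index :: "('a, 'b) monoid_scheme \<Rightarrow> nat \<Rightarrow> bool" where
  "last_full_exponent_index G d \<longleftrightarrow>
     (if carrier G = {\<one>\<^bsub>G\<^esub>} then d = 1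
      else d \<ge> 1 \<and> group_exponent (lower_central_group G d) = group_exponent G \<and>
           (\<forall>e > d. group_exponent (lower_central_group G e) \<noteq> group_exponent G))"

end

theory Submission
  imports Defs
begin

text \<open>Write \<open>[a, b] = a b a\<^sup>-\<^sup>1 b\<^sup>-\<^sup>1\<close>, let \<open>n = p ^ Suc e\<close> be the exponent of \<open>G\<close>, and let \<open>\<gamma>\<^sub>i\<close> be the
terms of the lower central series. For \<open>x\<close> in \<open>G\<close> and \<open>k\<close> in \<open>\<gamma>\<^sub>d\<close> of order \<open>n\<close> the product to be
shown trivial is the value at \<open>n\<close> of the sequence \<open>P(0) = 1\<close>, \<open>P(n+1) = x k\<^sup>n P(n)\<close>
(\<open>witness_product\<close>). Its left difference is \<open>P(n+1) P(n)\<^sup>-\<^sup>1 = x k\<^sup>n\<close>, and the difference of that is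
the constant \<open>x k x\<^sup>-\<^sup>1\<close>. So \<open>P\<close> is a polynomial sequence of degree two with respect to every
filtration \<open>F\<close> of subgroups with \<open>[F\<^sub>i, F\<^sub>j] \<subseteq> F\<^sub>i\<^sub>+\<^sub>j\<close>, \<open>x \<in> F\<^sub>1\<close> and \<open>k \<in> F\<^sub>2\<close>. Polynomial sequences
form a group (\<open>poly_seq_closed\<close>, a theorem of Lazard and Leibman), which yields a Hall-Petrescu
expansion (\<open>poly_seq_binomial_expansion\<close>)

\<open>P(n) = a\<^sub>1\<^bsup>C(n,1)\<^esup> a\<^sub>2\<^bsup>C(n,2)\<^esup> a\<^sub>3\<^bsup>C(n,3)\<^esup> \<dots>\<close> with \<open>a\<^sub>j \<in> F\<^sub>j\<close>.

The first two factors are trivial because \<open>n\<close> is odd and is the exponent of \<open>G\<close>. By the choice of \<open>d\<close>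
the elements of \<open>\<gamma>\<^bsub>d+1\<^esub>\<close> are killed by \<open>p ^ e\<close>, and \<open>p ^ e\<close> divides \<open>C(n,j)\<close> unless \<open>p\<^sup>2\<close> divides
\<open>j\<close>. So, as soon as \<open>F\<^sub>3 \<subseteq> \<gamma>\<^bsub>d+1\<^esub>\<close>, every factor with such an index \<open>j \<ge> 3\<close> is trivial as well.

If \<open>d \<ge> 2\<close>, take \<open>F\<^sub>1\<close> generated by \<open>x\<close> and \<open>\<gamma>\<^sub>d\<close>, and \<open>F\<^sub>i = \<gamma>\<^bsub>d+i-2\<^esub>\<close> for \<open>i \<ge> 2\<close>. The hypothesis on the
class says \<open>\<gamma>\<^bsub>d+6\<^esub> = 1\<close>, so \<open>F\<^sub>8 = 1\<close> and only indices below \<open>8 < p\<^sup>2\<close> occur (\<open>witness_product_deep\<close>).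

If \<open>d = 1\<close>, pass to the subgroup generated by \<open>x\<close> and \<open>k\<close> and use each \<open>\<gamma>\<^sub>i\<close> twice,
\<open>F\<^bsub>2i-1\<^esub> = F\<^bsub>2i\<^esub> = \<gamma>\<^sub>i\<close>. Now the indices go up to 12, and the only bad one is \<open>j = 9\<close> for \<open>p = 3\<close>. There
\<open>a\<^sub>9\<close> is the cube of an element of \<open>\<gamma>\<^sub>2\<close> (\<open>ninth_coefficient_is_cube\<close>), which supplies the missing factor
3. Indeed \<open>\<gamma>\<^sub>2\<close> has class at most two for a two-generated group of class six, so its cubes form a
normal subgroup; in the quotient by it one computes \<open>P(9) = x\<^sup>9 k\<^sup>3\<^sup>6\<close> by hand (\<open>witness_product_nine\<close>),
and comparison with the expansion gives \<open>a\<^sub>9 = 1\<close> there.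

A witness \<open>k\<close> makes \<open>G\<close> a \<open>J\<close>-group because the equation \<open>f(x k) = x f(x)\<close> can be solved by
recursion along the cycle \<open>x, x k, x k\<^sup>2, \<dots>\<close>, the triviality of the product being exactly the
condition that the recursion closes up.\<close>

section \<open>Words and commutators\<close>

context group
begin

definition commutator :: "'a \<Rightarrow> 'a \<Rightarrow> 'a" where
  "commutator a b = a \<otimes> b \<otimes> inv a \<otimes> inv b"

lemma inv_mult_cancel:
  assumes "x \<in> carrier G" "y \<in> carrier G"
  shows "inv x \<otimes> (x \<otimes> y) = y" "x \<otimes> (inv x \<otimes> y) = y"
  using assms by (simp_all flip: m_assoc)

text \<open>With these rules the simplifier decides equality of words in the free group: it normalises to
right-nested reduced words.\<close>

lemmas word_simps = m_assoc inv_mult_group inv_mult_cancel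

text \<open>Makes a rewrite rule for a product of two elements applicable inside right-nested words.\<close>

lemma assoc_rewrite:
  assumes "a \<otimes> b = d" "a \<in> carrier G" "b \<in> carrier G" "t \<in> carrier G"
  shows "a \<otimes> (b \<otimes> t) = d \<otimes> t"
  using assms by (simp add: m_assoc[symmetric])

lemma subgroup_nat_pow_closed: "subgroup H G \<Longrightarrow> a \<in> H \<Longrightarrow> a [^] (n::nat) \<in> H"
  by (induction n) (auto intro: subgroup.one_closed subgroup.m_closed)

lemma pow_eq_one_dvd:
  assumes "a \<in> carrier G" "a [^] (m::nat) = \<one>" "m dvd n"
  shows "a [^] n = \<one>"
  using assms by (auto simp: nat_pow_pow[symmetric] elim!: dvdE)

lemma conj_nat_pow:
  assumes "g \<in> carrier G" "a \<in> carrier G"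
  shows "(g \<otimes> a \<otimes> inv g) [^] (n::nat) = g \<otimes> a [^] n \<otimes> inv g"
  using assms by (induction n) (simp_all add: word_simps)

lemma commutator_closed [simp, intro]:
  "\<lbrakk>a \<in> carrier G; b \<in> carrier G\<rbrakk> \<Longrightarrow> commutator a b \<in> carrier G"
  by (simp add: commutator_def)

lemma commutator_self [simp]: "a \<in> carrier G \<Longrightarrow> commutator a a = \<one>"
  by (simp add: commutator_def m_assoc)

lemma inv_commutator:
  "\<lbrakk>a \<in> carrier G; b \<in> carrier G\<rbrakk> \<Longrightarrow> inv (commutator a b) = commutator b a"
  by (simp add: commutator_def word_simps)

lemma conj_eq_commutator_mult:
  "\<lbrakk>a \<in> carrier G; u \<in> carrier G\<rbrakk> \<Longrightarrow> a \<otimes> u \<otimes> inv a = commutator a u \<otimes> u"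
  by (simp add: commutator_def word_simps)

lemma commutator_mult_left:
  assumes "a \<in> carrier G" "b \<in> carrier G" "v \<in> carrier G"
  shows "commutator (a \<otimes> b) v = a \<otimes> commutator b v \<otimes> inv a \<otimes> commutator a v"
  using assms by (simp add: commutator_def word_simps)

lemma commutator_mult_right:
  assumes "b \<in> carrier G" "c \<in> carrier G" "u \<in> carrier G"
  shows "commutator u (b \<otimes> c) = commutator u b \<otimes> (b \<otimes> commutator u c \<otimes> inv b)"
  using assms by (simp add: commutator_def word_simps)

text \<open>The left difference of a sequence of commutators \<open>[g(n), h(n)]\<close>, with \<open>a\<close> and \<open>b\<close> the left
differences of \<open>g\<close> and \<open>h\<close>. The right-hand side is arranged as a product of commutators in which
\<open>f\<close> itself occurs only inside further commutators; this is what makes the induction in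
\<open>poly_seq_closed\<close> work.\<close>

lemma commutator_mult_mult:
  assumes [simp]: "a \<in> carrier G" "b \<in> carrier G" "g \<in> carrier G" "h \<in> carrier G"
  defines "f \<equiv> commutator g h"
    and "w \<equiv> commutator a b \<otimes> (commutator b (commutator a h) \<otimes> commutator a h)"
  shows "commutator (a \<otimes> g) (b \<otimes> h) \<otimes> inv f =
    commutator a (commutator g b) \<otimes>
      (commutator g b \<otimes> (commutator (a \<otimes> b) f \<otimes> (commutator f w \<otimes> w)))"
proof -
  have f [simp]: "f \<in> carrier G" and w [simp]: "w \<in> carrier G" by (simp_all add: f_def w_def)
  have ah: "commutator a (b \<otimes> h) = w"
    by (simp add: commutator_mult_right conj_eq_commutator_mult w_def)
  have gh: "commutator g (b \<otimes> h) = commutator g b \<otimes> (b \<otimes> f \<otimes> inv b)"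
    by (simp add: commutator_mult_right f_def)
  have shuffle: "a \<otimes> (c \<otimes> (b \<otimes> f \<otimes> inv b)) \<otimes> inv a \<otimes> w \<otimes> inv f =
      (a \<otimes> c \<otimes> inv a) \<otimes> (a \<otimes> b \<otimes> f \<otimes> inv (a \<otimes> b)) \<otimes> (inv f \<otimes> (f \<otimes> w \<otimes> inv f))"
    if "c \<in> carrier G" for c
    using that by (simp add: word_simps)
  have "commutator (a \<otimes> g) (b \<otimes> h) \<otimes> inv f =
      a \<otimes> (commutator g b \<otimes> (b \<otimes> f \<otimes> inv b)) \<otimes> inv a \<otimes> w \<otimes> inv f"
    by (simp add: commutator_mult_left ah gh)
  also have "\<dots> = (commutator a (commutator g b) \<otimes> commutator g b) \<otimes>
      (commutator (a \<otimes> b) f \<otimes> f) \<otimes> (inv f \<otimes> (commutator f w \<otimes> w))"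
    by (subst shuffle) (simp_all only: conj_eq_commutator_mult commutator_closed m_closed f w assms)
  also have "\<dots> = commutator a (commutator g b) \<otimes>
      (commutator g b \<otimes> (commutator (a \<otimes> b) f \<otimes> (commutator f w \<otimes> w)))"
    by (simp add: word_simps)
  finally show ?thesis .
qed

lemma commutator_inv_left:
  assumes "a \<in> carrier G" "v \<in> carrier G"
  shows "commutator (inv a) v = inv a \<otimes> inv (commutator a v) \<otimes> a"
  using assms by (simp add: commutator_def word_simps)

lemma conj_commutator:
  assumes "g \<in> carrier G" "a \<in> carrier G" "b \<in> carrier G"
  shows "g \<otimes> commutator a b \<otimes> inv g = commutator (g \<otimes> a \<otimes> inv g) (g \<otimes> b \<otimes> inv g)"
  using assms by (simp add: commutator_def word_simps)

lemma commutator_eq_one_commute: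
  assumes "a \<in> carrier G" "b \<in> carrier G" "commutator a b = \<one>"
  shows "a \<otimes> b = b \<otimes> a"
  using assms conj_eq_commutator_mult[of a b] inv_solve_right'[of b "a \<otimes> b" a] by simp

lemma Hall_Witt:
  assumes "a \<in> carrier G" "b \<in> carrier G" "c \<in> carrier G"
  shows "commutator (commutator a b) (b \<otimes> c \<otimes> inv b)
       \<otimes> commutator (commutator b c) (c \<otimes> a \<otimes> inv c)
       \<otimes> commutator (commutator c a) (a \<otimes> b \<otimes> inv a) = \<one>"
  using assms by (simp add: commutator_def word_simps)

lemma commutator_in_subgroup_sym:
  assumes "subgroup L G" "a \<in> carrier G" "b \<in> carrier G" "commutator a b \<in> L"
  shows "commutator b a \<in> L"
  using subgroup.m_inv_closed[OF assms(1,4)] inv_commutator[OF assms(2,3)] by argo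

lemma normal_commutator_closed:
  assumes N: "N \<lhd> G" and a: "a \<in> N" and g: "g \<in> carrier G"
  shows "commutator a g \<in> N" "commutator g a \<in> N"
proof -
  interpret normal N G by (rule N)
  have "a \<otimes> (g \<otimes> inv a \<otimes> inv g) \<in> N" using a g inv_op_closed2 by simp
  then show "commutator a g \<in> N" using a g by (simp add: commutator_def m_assoc)
  show "commutator g a \<in> N" unfolding commutator_def using a g inv_op_closed2 by simp
qed

text \<open>Modulo a normal subgroup \<open>L\<close> the elements commuting with \<open>v\<close> form a subgroup, so it suffices to
check generators.\<close>

lemma commutator_in_normal_generate_left:
  assumes L: "L \<lhd> G" and A: "A \<subseteq> carrier G" and v: "v \<in> carrier G"
    and comm: "\<And>a. a \<in> A \<Longrightarrow> commutator a v \<in> L"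
    and u: "u \<in> generate G A"
  shows "commutator u v \<in> L"
proof -
  interpret L: normal L G by (rule L)
  show ?thesis using u
  proof (induction rule: generate.induct)
    case one
    show ?case using v by (simp add: commutator_def)
  next
    case (incl h)
    then show ?case by (rule comm)
  next
    case (inv h)
    then have "h \<in> carrier G" using A by blast
    then show ?case
      using v L.inv_op_closed1[of h "inv (commutator h v)"] comm[OF inv]
      by (simp add: commutator_inv_left)
  next
    case (eng a b)
    then have "a \<in> carrier G" "b \<in> carrier G" using A generate_in_carrier by blast+
    then show ?case
      using v eng L.inv_op_closed2[of a "commutator b v"] by (simp add: commutator_mult_left)
  qed
qed

lemma commutator_in_normal_generate:
  assumes L: "L \<lhd> G" and A: "A \<subseteq> carrier G" and B: "B \<subseteq> carrier G"
    and comm: "\<And>a b. \<lbrakk>a \<in> A; b \<in> B\<rbrakk> \<Longrightarrow> commutator a b \<in> L"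
    and u: "u \<in> generate G A" and v: "v \<in> generate G B"
  shows "commutator u v \<in> L"
proof -
  have sub: "subgroup L G" using L by (rule normal_imp_subgroup)
  have vc: "v \<in> carrier G" by (rule generate_in_carrier[OF B v])
  have "commutator a v \<in> L" if a: "a \<in> A" for a
  proof -
    have ac: "a \<in> carrier G" using a A by blast
    have "commutator b a \<in> L" if b: "b \<in> B" for b
    proof -
      have "b \<in> carrier G" using b B by blast
      then show ?thesis by (rule commutator_in_subgroup_sym[OF sub ac _ comm[OF a b]])
    qed
    then have "commutator v a \<in> L" by (rule commutator_in_normal_generate_left[OF L B ac _ v])
    then show ?thesis by (rule commutator_in_subgroup_sym[OF sub vc ac])
  qed
  then show ?thesis by (rule commutator_in_normal_generate_left[OF L A vc _ u])
qed

end

section \<open>The lower central series\<close>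

context group
begin

lemma commutator_subgroup_alt:
  "commutator_subgroup G H K = generate G (\<Union>h\<in>H. \<Union>k\<in>K. {commutator h k})"
  by (simp add: commutator_subgroup_def commutator_def)

lemma lower_central_0 [simp]: "lower_central G 0 = carrier G"
  and lower_central_1 [simp]: "lower_central G (Suc 0) = carrier G"
  and lower_central_Suc: "lower_central G (Suc (Suc i)) =
    generate G (\<Union>h\<in>lower_central G (Suc i). \<Union>k\<in>carrier G. {commutator h k})"
  by (simp_all add: lower_central_def flip: commutator_subgroup_alt)

lemma normal_lower_central: "lower_central G i \<lhd> G"
proof (induction i)
  case 0
  then show ?case by (simp add: normal_inv_iff subgroup_self)
next
  case (Suc i)
  show ?case
  proof (cases i)
    case 0
    then show ?thesis by (simp add: normal_inv_iff subgroup_self)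
  next
    case (Suc i')
    interpret N: normal "lower_central G (Suc i')" G using Suc.IH Suc by simp
    show ?thesis
      unfolding Suc lower_central_Suc
    proof (rule normal_generateI)
      show "(\<Union>h\<in>lower_central G (Suc i'). \<Union>k\<in>carrier G. {commutator h k}) \<subseteq> carrier G"
        by auto
      fix h g
      assume h: "h \<in> (\<Union>h\<in>lower_central G (Suc i'). \<Union>k\<in>carrier G. {commutator h k})"
        and g: "g \<in> carrier G"
      then obtain a b where "a \<in> lower_central G (Suc i')" "b \<in> carrier G" "h = commutator a b"
        by blast
      then have "g \<otimes> h \<otimes> inv g = commutator (g \<otimes> a \<otimes> inv g) (g \<otimes> b \<otimes> inv g)"
        "g \<otimes> a \<otimes> inv g \<in> lower_central G (Suc i')" "g \<otimes> b \<otimes> inv g \<in> carrier G"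
        using g N.inv_op_closed2 by (simp_all add: conj_commutator)
      then show "g \<otimes> h \<otimes> inv g \<in> (\<Union>h\<in>lower_central G (Suc i'). \<Union>k\<in>carrier G. {commutator h k})"
        by blast
    qed
  qed
qed

lemma subgroup_lower_central: "subgroup (lower_central G i) G"
  using normal_lower_central by (rule normal_imp_subgroup)

lemma lower_central_carrier: "a \<in> lower_central G i \<Longrightarrow> a \<in> carrier G"
  using subgroup.mem_carrier[OF subgroup_lower_central] .

lemma commutator_lower_central_carrier:
  assumes "a \<in> lower_central G i" "i \<ge> 1" "g \<in> carrier G"
  shows "commutator a g \<in> lower_central G (Suc i)"
  using assms by (cases i) (auto simp: lower_central_Suc intro!: generate.incl)

lemma lower_central_Suc_subset: "lower_central G (Suc i) \<subseteq> lower_central G i"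
proof (cases i)
  case (Suc j)
  show ?thesis
    unfolding Suc lower_central_Suc
    using normal_commutator_closed(1)[OF normal_lower_central]
    by (intro generate_subgroup_incl subgroup_lower_central) auto
qed simp

lemma lower_central_antimono: "i \<le> j \<Longrightarrow> lower_central G j \<subseteq> lower_central G i"
  by (rule lift_Suc_antimono_le) (rule lower_central_Suc_subset)

text \<open>The three subgroups argument: the Hall-Witt identity expresses \<open>[[h, g], a]\<close> through
\<open>[[g, c], h']\<close> and \<open>[[c, h], g']\<close>, where \<open>c, h', g'\<close> are conjugates of \<open>a, h, g\<close>; in both, the element
\<open>h\<close> enters with a smaller index than \<open>[h, g]\<close> has.\<close>

lemma commutator_lower_central:
  assumes "a \<in> lower_central G i" "b \<in> lower_central G j"
  shows "commutator a b \<in> lower_central G (i + j)"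
proof -
  note closed = lower_central_carrier
  \<comment> \<open>Induction on the second index, for all first indices at once: the Hall-Witt identity moves a
    commutator from the right argument to the left one.\<close>
  have pos: "commutator a b \<in> lower_central G (i + Suc j)"
    if "a \<in> lower_central G i" "b \<in> lower_central G (Suc j)" "i \<ge> 1" for a b i j
    using that
  proof (induction j arbitrary: a b i)
    case 0
    then show ?case using commutator_lower_central_carrier by simp
  next
    case (Suc j)
    let ?L = "lower_central G (i + Suc (Suc j))"
    note L = normal_lower_central[of "i + Suc (Suc j)"]
    interpret L: normal ?L G by (rule L)
    have u: "a \<in> carrier G" using closed[OF Suc.prems(1)] .
    have gens: "commutator v a \<in> ?L"
      if "v \<in> (\<Union>h\<in>lower_central G (Suc j). \<Union>k\<in>carrier G. {commutator h k})" for v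
    proof -
      from that obtain h g where h: "h \<in> lower_central G (Suc j)" and g: "g \<in> carrier G"
        and v: "v = commutator h g" by blast
      have hc: "h \<in> carrier G" using closed[OF h] .
      \<comment> \<open>With this choice the first factor of the Hall-Witt identity is the commutator wanted here,
        and the induction hypothesis handles the other two.\<close>
      define c where "c = inv g \<otimes> a \<otimes> g"
      have c: "c \<in> lower_central G i"
        unfolding c_def using normal.inv_op_closed1[OF normal_lower_central g Suc.prems(1)] .
      have cc: "c \<in> carrier G" using closed[OF c] .
      have gcg: "g \<otimes> c \<otimes> inv g = a" using g u by (simp add: c_def word_simps)
      have "commutator c g \<in> lower_central G (Suc i)"
        by (rule commutator_lower_central_carrier[OF c Suc.prems(3) g])
      then have "commutator g c \<in> lower_central G (Suc i)"
        by (rule commutator_in_subgroup_sym[OF subgroup_lower_central cc g])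
      moreover have "c \<otimes> h \<otimes> inv c \<in> lower_central G (Suc j)"
        using normal.inv_op_closed2[OF normal_lower_central cc h] .
      ultimately have 2: "commutator (commutator g c) (c \<otimes> h \<otimes> inv c) \<in> ?L"
        using Suc.IH[of "commutator g c" "Suc i" "c \<otimes> h \<otimes> inv c"]
        le_add1[of 1 i] unfolding add_Suc add_Suc_right plus_1_eq_Suc by blast
      have "commutator c h \<in> lower_central G (i + Suc j)"
        using Suc.IH[OF c h Suc.prems(3)] .
      then have 3: "commutator (commutator c h) (h \<otimes> g \<otimes> inv h) \<in> ?L"
        using commutator_lower_central_carrier[of "commutator c h" "i + Suc j" "h \<otimes> g \<otimes> inv h"]
          hc g by simp
      have "commutator (commutator h g) a \<otimes> (commutator (commutator g c) (c \<otimes> h \<otimes> inv c)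
         \<otimes> commutator (commutator c h) (h \<otimes> g \<otimes> inv h)) = \<one>"
        using Hall_Witt[OF hc g cc] hc g cc u by (simp add: gcg m_assoc)
      then have "commutator (commutator h g) a = inv (commutator (commutator g c) (c \<otimes> h \<otimes> inv c)
         \<otimes> commutator (commutator c h) (h \<otimes> g \<otimes> inv h))"
        using hc g cc u by (intro inv_equality[symmetric]) simp_all
      then show ?thesis
        unfolding v using L.m_inv_closed[OF L.m_closed[OF 2 3]] by (rule ssubst)
    qed
    have "(\<Union>h\<in>lower_central G (Suc j). \<Union>k\<in>carrier G. {commutator h k}) \<subseteq> carrier G"
      by (auto dest: closed)
    from commutator_in_normal_generate_left[OF L this u gens
        Suc.prems(2)[unfolded lower_central_Suc[of j]]]
    have "commutator b a \<in> ?L" .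
    then show ?case
      by (rule commutator_in_subgroup_sym[OF subgroup_lower_central closed[OF Suc.prems(2)] u])
  qed
  show ?thesis
  proof (cases "i = 0 \<or> j = 0")
    case True
    then show ?thesis
      using assms normal_commutator_closed[OF normal_lower_central] closed by auto
  next
    case False
    then show ?thesis using pos[of a i b "j - 1"] assms by simp
  qed
qed

lemma normal_subset_lower_central:
  assumes L: "subgroup L G" and "lower_central G (Suc i) \<subseteq> L" "L \<subseteq> lower_central G i" "i \<ge> 1"
  shows "L \<lhd> G"
proof -
  interpret L: subgroup L G by (rule L)
  have "g \<otimes> u \<otimes> inv g \<in> L" if u: "u \<in> L" and g: "g \<in> carrier G" for u g
  proof -
    have uc: "u \<in> carrier G" using u by simp
    have "commutator u g \<in> L"
      using commutator_lower_central_carrier[of u i g] assms(2-4) u g by blast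
    then have "commutator g u \<in> L" by (rule commutator_in_subgroup_sym[OF L uc g])
    then show ?thesis using u by (simp add: conj_eq_commutator_mult[OF g uc])
  qed
  then show ?thesis using L by (simp add: normal_inv_iff)
qed

end

section \<open>Polynomial sequences in filtered groups\<close>

context group
begin

fun binomial_product :: "(nat \<Rightarrow> 'a) \<Rightarrow> nat \<Rightarrow> nat \<Rightarrow> 'a" where
  "binomial_product a n 0 = \<one>"
| "binomial_product a n (Suc s) = binomial_product a n s \<otimes> a s [^] (n choose s)"

lemma binomial_product_closed [simp]:
  "(\<And>j. a j \<in> carrier G) \<Longrightarrow> binomial_product a n s \<in> carrier G"
  by (induction s) auto

lemma binomial_product_eq_one:
  assumes "\<And>j. j < s \<Longrightarrow> a j [^] (n choose j) = \<one>"
  shows "binomial_product a n s = \<one>"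
  using assms by (induction s) auto

end

locale filtered_group = group +
  fixes F :: "nat \<Rightarrow> 'a set"
  assumes subgroup_F: "subgroup (F i) G"
    and F_Suc: "F (Suc i) \<subseteq> F i"
    and commutator_F: "\<lbrakk>a \<in> F i; b \<in> F j\<rbrakk> \<Longrightarrow> commutator a b \<in> F (i + j)"
begin

lemma F_antimono: "i \<le> j \<Longrightarrow> F j \<subseteq> F i"
  by (rule lift_Suc_antimono_le) (rule F_Suc)

lemma F_carrier [simp]: "a \<in> F i \<Longrightarrow> a \<in> carrier G"
  by (rule subgroup.mem_carrier[OF subgroup_F])

lemma F_trivial:
  assumes "F s = {\<one>}" "s \<le> i"
  shows "F i = {\<one>}"
  using assms F_antimono[OF assms(2)] subgroup.one_closed[OF subgroup_F, of i] by blast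

text \<open>A sequence is polynomial at level \<open>i\<close> if its \<open>m\<close>-fold left difference takes values in \<open>F (i + m)\<close>
for all \<open>m\<close>; here the condition is imposed for \<open>m \<le> r\<close> only. This truncation is the induction
parameter of \<open>poly_seq_closed\<close>: without it the differences of commutators lead to a circular argument.\<close>

fun poly_seq :: "nat \<Rightarrow> nat \<Rightarrow> (nat \<Rightarrow> 'a) \<Rightarrow> bool" where
  "poly_seq 0 i g \<longleftrightarrow> (\<forall>n. g n \<in> F i)"
| "poly_seq (Suc r) i g \<longleftrightarrow>
     (\<forall>n. g n \<in> F i) \<and> poly_seq r (Suc i) (\<lambda>n. g (Suc n) \<otimes> inv (g n))"

lemma poly_seq_range: "poly_seq r i g \<Longrightarrow> g n \<in> F i"
  by (cases r) auto

lemma poly_seq_carrier: "poly_seq r i g \<Longrightarrow> g n \<in> carrier G"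
  using poly_seq_range F_carrier by blast

lemma poly_seq_lower: "poly_seq r j g \<Longrightarrow> i \<le> j \<Longrightarrow> poly_seq r i g"
proof (induction r arbitrary: i j g)
  case 0
  then show ?case using F_antimono[of i j] by auto
next
  case (Suc r)
  then show ?case using F_antimono[of i j] Suc.IH[of "Suc j" _ "Suc i"] by auto
qed

lemma poly_seq_forget: "poly_seq (Suc r) i g \<Longrightarrow> poly_seq r i g"
proof (induction r arbitrary: i g)
  case (Suc r)
  note p = Suc.prems[unfolded poly_seq.simps(2)[of "Suc r"]]
  from p[THEN conjunct1] Suc.IH[OF p[THEN conjunct2]] show ?case by (subst poly_seq.simps) (rule conjI)
qed simp

text \<open>Polynomial sequences form a group, and commutators add levels. All three parts are proved together
by induction on \<open>r\<close>: the differences of the composed sequences are products of commutators of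
sequences to which the induction hypothesis applies, each of them involving a difference and
therefore living one level higher.\<close>

lemma poly_seq_closed:
  "poly_seq r i g \<Longrightarrow> poly_seq r i h \<Longrightarrow> poly_seq r i (\<lambda>n. g n \<otimes> h n)"
  "poly_seq r i g \<Longrightarrow> poly_seq r i (\<lambda>n. inv (g n))"
  "poly_seq r i g \<Longrightarrow> poly_seq r j h \<Longrightarrow> poly_seq r (i + j) (\<lambda>n. commutator (g n) (h n))"
proof (induction r arbitrary: i j g h)
  case 0
  {
    case 1 then show ?case by (auto intro: subgroup.m_closed[OF subgroup_F])
  next
    case 2 then show ?case by (auto intro: subgroup.m_inv_closed[OF subgroup_F])
  next
    case 3 then show ?case by (auto intro: commutator_F)
  }
next
  case (Suc r)
  note mult = Suc.IH(1) and minv = Suc.IH(2) and comm = Suc.IH(3)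
  {
    case 1
    define a b where "a = (\<lambda>n. g (Suc n) \<otimes> inv (g n))" and "b = (\<lambda>n. h (Suc n) \<otimes> inv (h n))"
    note car = poly_seq_carrier[OF 1(1)] poly_seq_carrier[OF 1(2)]
    have a: "poly_seq r (Suc i) a" and b: "poly_seq r (Suc i) b" using 1 by (auto simp: a_def b_def)
    have "poly_seq r (i + Suc i) (\<lambda>n. commutator (g n) (b n))"
      using poly_seq_forget[OF 1(1)] b by (rule comm)
    then have gb: "poly_seq r (Suc i) (\<lambda>n. commutator (g n) (b n))" by (rule poly_seq_lower) simp
    \<comment> \<open>The difference of a product differs from the product of the differences by a commutator that
      itself involves a difference.\<close>
    have "g (Suc n) \<otimes> h (Suc n) \<otimes> inv (g n \<otimes> h n) = a n \<otimes> (commutator (g n) (b n) \<otimes> b n)" for n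
      using car[of n] car[of "Suc n"] by (simp add: a_def b_def commutator_def word_simps)
    moreover have "poly_seq r (Suc i) (\<lambda>n. a n \<otimes> (commutator (g n) (b n) \<otimes> b n))"
      by (intro mult a b gb)
    moreover have "g n \<otimes> h n \<in> F i" for n
      using 1 by (intro subgroup.m_closed[OF subgroup_F]) auto
    ultimately show ?case by simp
  next
    case 2
    define a where "a = (\<lambda>n. g (Suc n) \<otimes> inv (g n))"
    note car = poly_seq_carrier[OF 2]
    have a: "poly_seq r (Suc i) a" using 2 by (auto simp: a_def)
    note ia = minv[OF a]
    have "poly_seq r (i + Suc i) (\<lambda>n. commutator (inv (g n)) (inv (a n)))"
      using minv[OF poly_seq_forget[OF 2]] ia by (rule comm)
    then have ga: "poly_seq r (Suc i) (\<lambda>n. commutator (inv (g n)) (inv (a n)))"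
      by (rule poly_seq_lower) simp
    have "inv (g (Suc n)) \<otimes> inv (inv (g n)) = commutator (inv (g n)) (inv (a n)) \<otimes> inv (a n)" for n
      using car[of n] car[of "Suc n"] by (simp add: a_def commutator_def word_simps)
    moreover have "poly_seq r (Suc i) (\<lambda>n. commutator (inv (g n)) (inv (a n)) \<otimes> inv (a n))"
      by (intro mult ia ga)
    moreover have "inv (g n) \<in> F i" for n
      using 2 by (intro subgroup.m_inv_closed[OF subgroup_F]) auto
    ultimately show ?case by simp
  next
    case 3
    define a b f w where "a = (\<lambda>n. g (Suc n) \<otimes> inv (g n))" and "b = (\<lambda>n. h (Suc n) \<otimes> inv (h n))"
      and "f = (\<lambda>n. commutator (g n) (h n))"
      and "w = (\<lambda>n. commutator (a n) (b n) \<otimes>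
        (commutator (b n) (commutator (a n) (h n)) \<otimes> commutator (a n) (h n)))"
    let ?t = "Suc (i + j)"
    note car = poly_seq_carrier[OF 3(1)] poly_seq_carrier[OF 3(2)]
    have a: "poly_seq r (Suc i) a" and b: "poly_seq r (Suc j) b" using 3 by (auto simp: a_def b_def)
    note g = poly_seq_forget[OF 3(1)] and h = poly_seq_forget[OF 3(2)]
    have f: "poly_seq r (i + j) f" unfolding f_def by (rule comm[OF g h])
    note lower = poly_seq_lower[where i = ?t]
    have ah: "poly_seq r ?t (\<lambda>n. commutator (a n) (h n))" using comm[OF a h] by simp
    have gb: "poly_seq r ?t (\<lambda>n. commutator (g n) (b n))" using comm[OF g b] by simp
    have w: "poly_seq r ?t w"
      unfolding w_def by (intro mult ah lower[OF comm[OF a b]] lower[OF comm[OF b ah]]) simp_all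
    have "poly_seq r 1 (\<lambda>n. a n \<otimes> b n)"
      by (intro mult poly_seq_lower[OF a] poly_seq_lower[OF b]) simp_all
    from comm[OF this f] have abf: "poly_seq r ?t (\<lambda>n. commutator (a n \<otimes> b n) (f n))" by simp
    have all: "poly_seq r ?t (\<lambda>n. commutator (a n) (commutator (g n) (b n)) \<otimes>
       (commutator (g n) (b n) \<otimes> (commutator (a n \<otimes> b n) (f n) \<otimes> (commutator (f n) (w n) \<otimes> w n))))"
      by (intro mult gb abf w lower[OF comm[OF a gb]] lower[OF comm[OF f w]]) simp_all
    have eq: "commutator (g (Suc n)) (h (Suc n)) \<otimes> inv (commutator (g n) (h n)) =
       commutator (a n) (commutator (g n) (b n)) \<otimes>
       (commutator (g n) (b n) \<otimes> (commutator (a n \<otimes> b n) (f n) \<otimes> (commutator (f n) (w n) \<otimes> w n)))" for n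
    proof -
      have c: "a n \<in> carrier G" "b n \<in> carrier G" "g n \<in> carrier G" "h n \<in> carrier G"
        using car[of n] poly_seq_carrier[OF a] poly_seq_carrier[OF b] by auto
      have "g (Suc n) = a n \<otimes> g n" "h (Suc n) = b n \<otimes> h n"
        using car[of n] car[of "Suc n"] by (simp_all add: a_def b_def word_simps)
      then show ?thesis
        using c by (simp add: w_def f_def commutator_mult_mult)
    qed
    show ?case using all 3 unfolding poly_seq.simps eq by (auto intro: commutator_F)
  }
qed

lemma poly_seq_const:
  assumes "a \<in> F i"
  shows "poly_seq r i (\<lambda>_. a)"
proof -
  have one: "poly_seq r i (\<lambda>_. \<one>)" for r i
    by (induction r arbitrary: i) (auto intro: subgroup.one_closed[OF subgroup_F])
  show ?thesis using assms by (cases r) (auto simp: one)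
qed

lemma poly_seq_one: "poly_seq r i (\<lambda>_. \<one>)"
  by (rule poly_seq_const) (rule subgroup.one_closed[OF subgroup_F])

text \<open>Pascal's rule: the difference of \<open>a\<^bsup>C(n,j)\<^esup>\<close> is \<open>a\<^bsup>C(n,j-1)\<^esup>\<close>.\<close>

lemma poly_seq_power_binomial:
  assumes "a \<in> F (i + j)"
  shows "poly_seq r i (\<lambda>n. a [^] (n choose j))"
  using assms
proof (induction r arbitrary: i j)
  case (0 i j)
  then have "a \<in> F i" using F_antimono[of i "i + j"] by auto
  then show ?case by (auto intro: subgroup_nat_pow_closed[OF subgroup_F])
next
  case (Suc r i j)
  have ai: "a \<in> F i" using Suc.prems F_antimono[of i "i + j"] by auto
  have "poly_seq r (Suc i) (\<lambda>n. a [^] (Suc n choose j) \<otimes> inv (a [^] (n choose j)))"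
  proof (cases j)
    case 0
    then show ?thesis using Suc.prems by (simp add: poly_seq_one)
  next
    case (Suc j')
    have "a [^] (Suc n choose j) \<otimes> inv (a [^] (n choose j)) = a [^] (n choose j')" for n
      using ai unfolding Suc by (simp add: nat_pow_mult[symmetric] m_assoc)
    then show ?thesis using Suc.IH[of "Suc i" j'] Suc.prems Suc by simp
  qed
  then show ?case using ai by (auto intro: subgroup_nat_pow_closed[OF subgroup_F])
qed

text \<open>The \<open>j\<close>-fold difference at 0 of a sequence vanishing below \<open>j\<close> is its value at \<open>j\<close>.\<close>

lemma poly_seq_first_value:
  assumes "poly_seq j i h" and "\<And>n. n < j \<Longrightarrow> h n = \<one>"
  shows "h j \<in> F (i + j)"
  using assms
proof (induction j arbitrary: i h)
  case 0
  then show ?case by simp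
next
  case (Suc j)
  have "h (Suc j) \<otimes> inv (h j) \<in> F (Suc i + j)"
    using Suc.prems by (intro Suc.IH) auto
  moreover have "h (Suc j) \<in> carrier G" using poly_seq_carrier[OF Suc.prems(1)] .
  ultimately show ?case using Suc.prems(2)[of j] by simp
qed

text \<open>The Hall-Petrescu expansion. The coefficients are peeled off one by one: once the sequence
is trivial below \<open>t\<close>, its value at \<open>t\<close> is the next coefficient, and dividing by the corresponding binomial
power leaves a polynomial sequence that is trivial below \<open>t + 1\<close>.\<close>

lemma poly_seq_binomial_expansion:
  assumes g: "\<And>r. poly_seq r i g" and s: "F (i + s) = {\<one>}"
  obtains a where "\<And>j. a j \<in> F (i + j)" "\<And>n. g n = binomial_product a n s"
proof -
  have "\<exists>a h. (\<forall>j. a j \<in> F (i + j)) \<and> (\<forall>r. poly_seq r i h) \<and> (\<forall>n<t. h n = \<one>) \<and>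
          (\<forall>n. g n = binomial_product a n t \<otimes> h n)" for t
  proof (induction t)
    case 0
    have "\<forall>n. g n \<in> carrier G" using poly_seq_carrier[OF g] by blast
    then show ?case
      using g subgroup.one_closed[OF subgroup_F] by (intro exI[of _ "\<lambda>_. \<one>"] exI[of _ g]) auto
  next
    case (Suc t)
    then obtain a h where a: "\<And>j. a j \<in> F (i + j)" and h: "\<And>r. poly_seq r i h"
      and h1: "\<And>n. n < t \<Longrightarrow> h n = \<one>" and gh: "\<And>n. g n = binomial_product a n t \<otimes> h n"
      by blast
    have hc: "h n \<in> carrier G" for n using poly_seq_carrier[OF h] .
    have ht: "h t \<in> F (i + t)" using poly_seq_first_value[OF h h1] .
    define a' where "a' = a(t := h t)"
    define h' where "h' = (\<lambda>n. inv (h t [^] (n choose t)) \<otimes> h n)"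
    have a': "a' j \<in> F (i + j)" for j using a ht by (simp add: a'_def)
    have "poly_seq r i h'" for r
      unfolding h'_def by (intro poly_seq_closed(1,2) h poly_seq_power_binomial ht)
    moreover have "h' n = \<one>" if "n < Suc t" for n
      using that hc h1 unfolding less_Suc_eq by (auto simp: h'_def binomial_eq_0)
    moreover have "g n = binomial_product a' n (Suc t) \<otimes> h' n" for n
    proof -
      have "binomial_product a' n u = binomial_product a n u" if "u \<le> t" for u
        using that by (induction u) (auto simp: a'_def)
      moreover have "binomial_product a n t \<in> carrier G"
        by (intro binomial_product_closed F_carrier[OF a])
      ultimately show ?thesis
        using hc by (simp add: gh a'_def h'_def word_simps)
    qed
    ultimately show ?case using a' by blast
  qed
  then obtain a h where a: "\<And>j. a j \<in> F (i + j)" and h: "\<And>r. poly_seq r i h"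
    and h1: "\<And>n. n < s \<Longrightarrow> h n = \<one>" and gh: "\<And>n. g n = binomial_product a n s \<otimes> h n"
    by blast
  \<comment> \<open>The remainder has its first non-trivial value, if any, in a trivial term of the filtration.\<close>
  have "h n = \<one>" for n
  proof (induction n rule: less_induct)
    case (less n)
    show ?case
    proof (cases "n < s")
      case False
      then have "h n \<in> F (i + s)"
        using poly_seq_first_value[OF h less.IH] F_antimono[of "i + s" "i + n"] by auto
      then show ?thesis by (simp add: s)
    qed (rule h1)
  qed
  then have "g n = binomial_product a n s" for n
    using gh binomial_product_closed[OF F_carrier[OF a]] by simp
  then show ?thesis using a that by blast
qed

lemma poly_seq_commutator_power:
  assumes "a \<in> F i" "b \<in> F 1"
  shows "poly_seq r i (\<lambda>n. commutator a (b [^] n))"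
  using poly_seq_closed(3)[OF poly_seq_const[OF assms(1)] poly_seq_power_binomial[of b 0 1 r]] assms(2)
  by simp

end

context group
begin

lemma filtered_group_lower_central: "filtered_group G (lower_central G)"
  by (intro filtered_group.intro filtered_group_axioms.intro is_group subgroup_lower_central
      lower_central_Suc_subset commutator_lower_central)

end

section \<open>Witness products as polynomial sequences\<close>

context group
begin

fun witness_product :: "'a \<Rightarrow> 'a \<Rightarrow> nat \<Rightarrow> 'a" where
  "witness_product x k 0 = \<one>"
| "witness_product x k (Suc n) = x \<otimes> k [^] n \<otimes> witness_product x k n"

lemma witness_product_closed [simp]:
  "\<lbrakk>x \<in> carrier G; k \<in> carrier G\<rbrakk> \<Longrightarrow> witness_product x k n \<in> carrier G"
  by (induction n) auto

end

context group_hom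
begin

lemma hom_commutator:
  assumes "a \<in> carrier G" "b \<in> carrier G"
  shows "h (G.commutator a b) = H.commutator (h a) (h b)"
  using assms by (simp add: G.commutator_def H.commutator_def)

lemma hom_witness_product:
  assumes "x \<in> carrier G" "k \<in> carrier G"
  shows "h (G.witness_product x k n) = H.witness_product (h x) (h k) n"
  using assms by (induction n) (simp_all add: hom_nat_pow)

lemma filtered_group_image:
  assumes "filtered_group G F"
  shows "filtered_group H (\<lambda>i. h ` F i)"
proof -
  interpret F: filtered_group G F by (rule assms)
  show ?thesis
  proof (intro filtered_group.intro filtered_group_axioms.intro)
    show "group H" ..
    show "subgroup (h ` F i) H" for i
      by (rule subgroup_img_is_subgroup[OF F.subgroup_F])
    show "h ` F (Suc i) \<subseteq> h ` F i" for i using F.F_Suc by blast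
    show "H.commutator u v \<in> h ` F (i + j)" if uv: "u \<in> h ` F i" "v \<in> h ` F j" for u v i j
    proof -
      obtain a b where a: "a \<in> F i" "u = h a" and b: "b \<in> F j" "v = h b" using uv by blast
      then have "H.commutator u v = h (G.commutator a b)"
        using hom_commutator F.F_carrier by simp
      then show ?thesis using F.commutator_F[OF a(1) b(1)] by blast
    qed
  qed
qed

end

context filtered_group
begin

text \<open>The first difference is \<open>x k\<^sup>n\<close> and the second one is the constant \<open>x k x\<^sup>-\<^sup>1\<close>, so placing \<open>x\<close> in
level 1 and \<open>k\<close> in level 2 is enough.\<close>

lemma poly_seq_witness_product:
  assumes x: "x \<in> F 1" and k: "k \<in> F 2"
  shows "poly_seq r 0 (witness_product x k)"
proof -
  have k1: "k \<in> F 1" using k F_antimono[of 1 2] by auto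
  have "x \<otimes> k \<otimes> inv x = commutator x k \<otimes> k" using x k by (simp add: commutator_def word_simps)
  then have xkx: "x \<otimes> k \<otimes> inv x \<in> F 2"
    using commutator_F[OF x k] F_antimono[of 2 3] k
    by (auto intro!: subgroup.m_closed[OF subgroup_F] simp: numeral_eq_Suc)
  have 2: "poly_seq r (Suc (Suc 0)) (\<lambda>n. x \<otimes> k [^] Suc n \<otimes> inv (x \<otimes> k [^] n))" for r
  proof -
    have "x \<otimes> k [^] Suc n \<otimes> inv (x \<otimes> k [^] n) = x \<otimes> k \<otimes> inv x" for n
    proof -
      have "k [^] Suc n = k \<otimes> k [^] n" using k by (intro nat_pow_Suc2) simp
      then show ?thesis using x k by (simp add: word_simps)
    qed
    then show ?thesis using poly_seq_const[OF xkx, of r] by (simp add: numeral_2_eq_2)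
  qed
  have 1: "poly_seq r (Suc 0) (\<lambda>n. x \<otimes> k [^] n)" for r
    using x k1 2 by (cases r) (auto intro!: subgroup.m_closed[OF subgroup_F] subgroup_nat_pow_closed[OF subgroup_F])
  have "poly_seq 0 0 (\<lambda>n. x \<otimes> k [^] n)" by (rule poly_seq_lower[OF 1]) simp
  then have xk: "x \<otimes> k [^] n \<in> F 0" for n :: nat by simp
  have range: "witness_product x k n \<in> F 0" for n
    using xk by (induction n) (auto intro: subgroup.m_closed[OF subgroup_F] subgroup.one_closed[OF subgroup_F])
  have "witness_product x k (Suc n) \<otimes> inv (witness_product x k n) = x \<otimes> k [^] n" for n
    using x k by (simp add: word_simps)
  then show ?thesis using range 1 by (cases r) auto
qed

text \<open>The coefficients with index at most 2 are determined by the values at 0, 1 and 2.\<close>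

lemma witness_product_expansion:
  assumes x: "x \<in> F 1" and k: "k \<in> F 2" and s: "F s = {\<one>}" "s \<ge> 3"
  obtains a where "\<And>j. a j \<in> F j" "a 0 = \<one>" "a 1 = x" "a 2 = inv x \<otimes> k \<otimes> x"
    "\<And>n. witness_product x k n = binomial_product a n s"
proof -
  obtain a where a: "\<And>j. a j \<in> F (0 + j)" and exp: "\<And>n. witness_product x k n = binomial_product a n s"
    using poly_seq_binomial_expansion[OF poly_seq_witness_product[OF x k], of s] s by auto
  have ac [simp]: "a j \<in> carrier G" for j using a by (rule F_carrier)
  note [simp] = F_carrier[OF x] F_carrier[OF k]
  have bc: "binomial_product a n t \<in> carrier G" for n t
    by (intro binomial_product_closed ac)
  have short: "binomial_product a n t = binomial_product a n (Suc n)" if "Suc n \<le> t" for n t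
    using that
  proof (induction t rule: dec_induct)
    case (step t)
    have "binomial_product a n (Suc t) = binomial_product a n t \<otimes> \<one>"
      using step.hyps by (simp add: binomial_eq_0)
    then show ?case using step.IH bc by (simp del: binomial_product.simps)
  qed simp
  have 0: "a 0 = \<one>" using exp[of 0] short[of 0 s] s by simp
  have 1: "a 1 = x" using exp[of 1] short[of 1 s] s by (simp add: 0)
  have "x \<otimes> k \<otimes> x = x \<otimes> x \<otimes> a 2"
    using exp[of 2] short[of 2 s] s 1 by (simp add: 0 eval_nat_numeral)
  then have "inv x \<otimes> (inv x \<otimes> (x \<otimes> k \<otimes> x)) = a 2" by (simp add: word_simps)
  then have 2: "a 2 = inv x \<otimes> k \<otimes> x" by (simp add: word_simps)
  show ?thesis using that[of a] a 0 1 2 exp by simp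
qed

end

section \<open>Binomial coefficients of prime powers\<close>

lemma odd_dvd_choose_two: "odd (n::nat) \<Longrightarrow> n dvd n choose 2"
proof (elim oddE)
  fix b assume b: "n = 2 * b + 1"
  have double: "n * (n - 1) = 2 * (n * b)" by (simp add: b)
  have "n choose 2 = n * b" unfolding choose_two double by simp
  then show "n dvd n choose 2" by simp
qed

text \<open>From \<open>j C(n,j) = n C(n-1,j-1)\<close>: at most one factor \<open>p\<close> is lost when \<open>p\<^sup>2\<close> does not divide \<open>j\<close>.\<close>

lemma prime_power_dvd_binomial:
  fixes p e j :: nat
  assumes p: "Factorial_Ring.prime p" and j: "0 < j" "\<not> p\<^sup>2 dvd j"
  shows "p ^ e dvd (p ^ Suc e choose j)"
proof -
  obtain i where i: "j = Suc i" using j by (cases j) auto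
  have "Suc (p ^ Suc e - 1) = p ^ Suc e" using p by (simp add: prime_gt_0_nat)
  then have absorb: "j * (p ^ Suc e choose j) = p ^ Suc e * (p ^ Suc e - 1 choose i)"
    using Suc_times_binomial[of i "p ^ Suc e - 1"] i by simp
  show ?thesis
  proof (cases "p dvd j")
    case True
    then obtain l where l: "j = p * l" by blast
    then have "\<not> p dvd l" using j(2) by (auto simp: power2_eq_square)
    then have "coprime (p ^ e) l" using p by (simp add: prime_imp_coprime_nat)
    moreover have "l * (p ^ Suc e choose j) = p ^ e * (p ^ Suc e - 1 choose i)"
      using absorb p unfolding l by (simp add: prime_gt_0_nat mult.assoc)
    then have "p ^ e dvd l * (p ^ Suc e choose j)" by simp
    ultimately show ?thesis by (simp add: coprime_dvd_mult_right_iff)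
  next
    case False
    then have "coprime (p ^ e) j" using p by (simp add: prime_imp_coprime_nat)
    moreover have "p ^ e dvd j * (p ^ Suc e choose j)" unfolding absorb by simp
    ultimately show ?thesis by (simp add: coprime_dvd_mult_right_iff)
  qed
qed

lemma three_power_dvd_binomial_nine: "3 ^ e dvd 3 * (3 ^ Suc e choose 9)"
proof -
  have "Suc (3 ^ Suc e - 1) = (3::nat) ^ Suc e" by simp
  then have "9 * (3 ^ Suc e choose 9) = (3::nat) ^ Suc e * (3 ^ Suc e - 1 choose 8)"
    using Suc_times_binomial[of 8 "3 ^ Suc e - 1"] by (simp add: numeral_eq_Suc)
  then have "3 * (3 ^ Suc e choose 9) = (3::nat) ^ e * (3 ^ Suc e - 1 choose 8)" by simp
  then show ?thesis by simp
qed

context group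
begin

lemma prime_power_binomial_product_eq_one:
  assumes p: "Factorial_Ring.prime p" "p > 2"
    and a: "\<And>j. a j \<in> carrier G" and exp: "\<And>g. g \<in> carrier G \<Longrightarrow> g [^] (p ^ Suc e) = \<one>"
    and a0: "a 0 = \<one>" and a3: "\<And>j. j \<ge> 3 \<Longrightarrow> a j [^] (p ^ e) = \<one>"
    and except: "\<And>j. \<lbrakk>j \<ge> 3; j < s; p\<^sup>2 dvd j\<rbrakk> \<Longrightarrow> a j [^] (p ^ Suc e choose j) = \<one>"
  shows "binomial_product a (p ^ Suc e) s = \<one>"
proof (rule binomial_product_eq_one)
  fix j assume j: "j < s"
  have odd: "odd (p ^ Suc e)" using p prime_odd_nat by simp
  consider "j = 0" | "j = 1" | "j = 2" | "j \<ge> 3" by linarith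
  then show "a j [^] (p ^ Suc e choose j) = \<one>"
  proof cases
    case 1
    then show ?thesis by (simp add: a0)
  next
    case 2
    then show ?thesis using exp[OF a] by simp
  next
    case 3
    then show ?thesis using odd_dvd_choose_two[OF odd] exp[OF a] pow_eq_one_dvd[OF a] by blast
  next
    case 4
    show ?thesis
    proof (cases "p\<^sup>2 dvd j")
      case False
      then have "p ^ e dvd p ^ Suc e choose j" using prime_power_dvd_binomial[OF p(1)] 4 by simp
      then show ?thesis using pow_eq_one_dvd[OF a a3[OF 4]] by blast
    qed (use except 4 j in blast)
  qed
qed

end

section \<open>The case of index at least two\<close>

context group
begin

text \<open>Replacing the whole group by the subgroup generated by \<open>x\<close> and \<open>\<gamma>\<^sub>d\<close> forces
\<open>[F\<^sub>1, F\<^sub>1] \<subseteq> \<gamma>\<^bsub>d+1\<^esub> \<subseteq> F\<^sub>2\<close>, since \<open>x\<close> commutes with itself. For \<open>i, j \<ge> 2\<close> the inclusion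
\<open>[F\<^sub>i, F\<^sub>j] \<subseteq> \<gamma>\<^bsub>2d+i+j-4\<^esub> \<subseteq> F\<^bsub>i+j\<^esub>\<close> is where \<open>d \<ge> 2\<close> enters.\<close>

lemma filtered_group_deep:
  assumes d: "d \<ge> 2" and x: "x \<in> carrier G"
  defines "F \<equiv> \<lambda>i. if i \<le> 1 then generate G (insert x (lower_central G d))
                   else lower_central G (d + i - 2)"
  shows "filtered_group G F"
proof -
  let ?S = "insert x (lower_central G d)"
  note closed = lower_central_carrier
  have S: "?S \<subseteq> carrier G" using x closed by blast
  have sub: "subgroup (generate G ?S) G" by (rule generate_is_subgroup[OF S])
  have anti: "u \<in> lower_central G j" if "u \<in> lower_central G i" "j \<le> i" for u i j
    using that lower_central_antimono by blast
  have car: "u \<in> carrier G" if "u \<in> F i" for u i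
    using that closed subgroup.mem_carrier[OF sub] by (auto simp: F_def split: if_splits)
  have low: "lower_central G d \<subseteq> F i" if "i \<le> 2" for i
    using that by (auto simp: F_def intro: generate.incl elim!: anti)
  have F_deep: "u \<in> F i" if "u \<in> lower_central G j" "j \<ge> d + i - 2" "j \<ge> d" for u i j
    using that low[of i] anti[OF that(1)] by (cases "i \<le> 1") (auto simp: F_def)
  have xS: "commutator x u \<in> lower_central G (Suc d)" if "u \<in> ?S" for u
  proof (cases "u = x")
    case True
    then show ?thesis using x subgroup.one_closed[OF subgroup_lower_central] by simp
  next
    case False
    then have u: "u \<in> lower_central G d" using that by simp
    have "commutator u x \<in> lower_central G (Suc d)"
      using commutator_lower_central_carrier[OF u _ x] d by simp
    then show ?thesis
      by (rule commutator_in_subgroup_sym[OF subgroup_lower_central closed[OF u] x])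
  qed
  have SS: "commutator u v \<in> lower_central G (Suc d)" if "u \<in> ?S" "v \<in> ?S" for u v
  proof (cases "u = x")
    case False
    then have u: "u \<in> lower_central G d" using that by simp
    have "v \<in> carrier G" using that(2) S by blast
    then show ?thesis using commutator_lower_central_carrier[OF u] d by simp
  qed (use xS that in simp)
  have gens: "commutator u v \<in> lower_central G (Suc d)" if "u \<in> generate G ?S" "v \<in> generate G ?S" for u v
    by (rule commutator_in_normal_generate[OF normal_lower_central S S SS that])
  have right: "commutator u v \<in> F (i + j)" if u: "u \<in> F i" and v: "v \<in> F j" and j: "j \<ge> 2" for u v i j
  proof -
    have v': "v \<in> lower_central G (d + j - 2)" using v j by (simp add: F_def)
    show ?thesis
    proof (cases "i \<le> 1")
      case True
      have "commutator v u \<in> lower_central G (Suc (d + j - 2))"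
        by (rule commutator_lower_central_carrier[OF v' _ car[OF u]]) (use d j in linarith)
      then have "commutator u v \<in> lower_central G (Suc (d + j - 2))"
        by (rule commutator_in_subgroup_sym[OF subgroup_lower_central car[OF v] car[OF u]])
      then show ?thesis by (rule F_deep) (use True d j in linarith)+
    next
      case False
      then have "u \<in> lower_central G (d + i - 2)" using u by (simp add: F_def)
      from commutator_lower_central[OF this v'] show ?thesis
        by (rule F_deep) (use False d j in linarith)+
    qed
  qed
  show ?thesis
  proof (intro filtered_group.intro filtered_group_axioms.intro is_group)
    show Fsub: "subgroup (F i) G" for i
      using sub subgroup_lower_central by (simp add: F_def)
    show "F (Suc i) \<subseteq> F i" for i
    proof (cases "i \<le> 1")
      case True
      then show ?thesis using low[of i] by (cases i) (auto simp: F_def)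
    next
      case False
      then show ?thesis using lower_central_antimono[of "d + i - 2" "d + Suc i - 2"] by (simp add: F_def)
    qed
    show "commutator u v \<in> F (i + j)" if u: "u \<in> F i" and v: "v \<in> F j" for u v i j
    proof (cases "i \<le> 1 \<and> j \<le> 1")
      case True
      then have "commutator u v \<in> lower_central G (Suc d)" using gens u v by (simp add: F_def)
      then show ?thesis by (rule F_deep) (use True in linarith)+
    next
      case False
      then consider "j \<ge> 2" | "i \<ge> 2" by linarith
      then show ?thesis
      proof cases
        case 1
        then show ?thesis by (rule right[OF u v])
      next
        case 2
        then have "commutator v u \<in> F (i + j)" using right[OF v u] by (simp add: add.commute)
        then show ?thesis by (rule commutator_in_subgroup_sym[OF Fsub car[OF v] car[OF u]])
      qed
    qed
  qed
qed

text \<open>The filtration is trivial from index 8 on, and no index below 8 is divisible by the square of an odd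
prime.\<close>

lemma witness_product_deep:
  assumes p: "Factorial_Ring.prime p" "p > 2" and d: "d \<ge> 2"
    and triv: "lower_central G (d + 6) = {\<one>}"
    and exp: "\<And>g. g \<in> carrier G \<Longrightarrow> g [^] (p ^ Suc e) = \<one>"
    and exp': "\<And>u. u \<in> lower_central G (Suc d) \<Longrightarrow> u [^] (p ^ e) = \<one>"
    and x: "x \<in> carrier G" and k: "k \<in> lower_central G d"
  shows "witness_product x k (p ^ Suc e) = \<one>"
proof -
  define F where "F = (\<lambda>i. if i \<le> 1 then generate G (insert x (lower_central G d))
                   else lower_central G (d + i - 2))"
  interpret F: filtered_group G F unfolding F_def by (rule filtered_group_deep[OF d x])
  have x1: "x \<in> F 1" by (simp add: F_def generate.incl)
  have k2: "k \<in> F 2" using k by (simp add: F_def)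
  have F8: "F 8 = {\<one>}" using triv by (simp add: F_def add.commute)
  obtain a where a: "\<And>j. a j \<in> F j" and a0: "a 0 = \<one>"
    and prod: "\<And>n. witness_product x k n = binomial_product a n 8"
    by (rule F.witness_product_expansion[OF x1 k2 F8]) auto
  show ?thesis
    unfolding prod
  proof (rule prime_power_binomial_product_eq_one[where a = a, OF p _ exp a0])
    show "a j \<in> carrier G" for j using a by (rule F.F_carrier)
    show "a j [^] (p ^ e) = \<one>" if "3 \<le> j" for j
      using exp' a[of j] that F.F_antimono[OF that] by (auto simp: F_def)
    show "a j [^] (p ^ Suc e choose j) = \<one>" if j: "3 \<le> j" "j < 8" "p\<^sup>2 dvd j" for j
    proof -
      have "3\<^sup>2 \<le> p\<^sup>2" using p(2) by (intro power_mono) auto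
      moreover have "p\<^sup>2 \<le> j" using j by (intro dvd_imp_le) auto
      ultimately show ?thesis using j by simp
    qed
  qed
qed

end

section \<open>The case of index one\<close>

context group
begin

text \<open>Each term of the lower central series is used twice, so that all elements of the group lie in
level 2.\<close>

lemma filtered_group_halved:
  "filtered_group G (\<lambda>i. lower_central G ((i + 1) div 2))"
proof (intro filtered_group.intro filtered_group_axioms.intro is_group subgroup_lower_central)
  show "lower_central G ((Suc i + 1) div 2) \<subseteq> lower_central G ((i + 1) div 2)" for i
    by (intro lower_central_antimono div_le_mono) simp
  show "commutator u v \<in> lower_central G ((i + j + 1) div 2)"
    if "u \<in> lower_central G ((i + 1) div 2)" "v \<in> lower_central G ((j + 1) div 2)" for u v i j
  proof -
    have "(i + j + 1) div 2 \<le> (i + 1) div 2 + (j + 1) div 2" by linarith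
    then show ?thesis using commutator_lower_central[OF that] lower_central_antimono by blast
  qed
qed

end

context filtered_group
begin

text \<open>Expansion of \<open>n \<mapsto> [a, b\<^sup>n]\<close> at 3 and 9: the coefficients with index 1 to 6 lie in a group of
exponent 3, the binomial coefficients \<open>C(9,1), \<dots>, C(9,6)\<close> are divisible by 3, and so are
\<open>C(3,1)\<close> and \<open>C(3,2)\<close>; hence cubing \<open>b\<close> gains three levels.\<close>

lemma commutator_power_cube_exponent:
  assumes triv: "F 7 = {\<one>}" and cube: "\<And>u. u \<in> F 2 \<Longrightarrow> u [^] (3::nat) = \<one>"
    and a: "a \<in> F i" and i: "i \<ge> 1" and b: "b \<in> F 1"
  shows "commutator a (b [^] (3::nat)) \<in> F (i + 3)" and "commutator a (b [^] (9::nat)) = \<one>"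
proof -
  have "F (i + 7) = {\<one>}" by (rule F_trivial[OF triv]) simp
  then obtain u where u: "\<And>j. u j \<in> F (i + j)"
    and exp: "\<And>n. commutator a (b [^] n) = binomial_product u n 7"
    using poly_seq_binomial_expansion[OF poly_seq_commutator_power[OF a b]] by metis
  have uc [simp]: "u j \<in> carrier G" for j using u by (rule F_carrier)
  have "u 0 = commutator a (b [^] (0::nat))" unfolding exp by (simp add: eval_nat_numeral)
  then have u0: "u 0 = \<one>" using a b by (simp add: commutator_def)
  have kill: "u j [^] n = \<one>" if "j \<ge> 1" "3 dvd n" for j and n :: nat
  proof -
    have "u j \<in> F 2" using u[of j] F_antimono[of 2 "i + j"] that i by auto
    then show ?thesis using that cube pow_eq_one_dvd[of "u j" 3 n] by simp
  qed
  have seven: "binomial_product u n 7 = u 0 [^] (n choose 0) \<otimes> u 1 [^] (n choose 1) \<otimes>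
    u 2 [^] (n choose 2) \<otimes> u 3 [^] (n choose 3) \<otimes> u 4 [^] (n choose 4) \<otimes>
    u 5 [^] (n choose 5) \<otimes> u 6 [^] (n choose 6)" for n
    by (simp add: eval_nat_numeral del: binomial_Suc_Suc)
  have three: "(3::nat) choose 1 = 3" "(3::nat) choose 2 = 3" "(3::nat) choose 3 = 1"
     "(3::nat) choose 4 = 0" "(3::nat) choose 5 = 0" "(3::nat) choose 6 = 0"
    by (simp_all add: eval_nat_numeral)
  have nine: "(9::nat) choose 1 = 9" "(9::nat) choose 2 = 36" "(9::nat) choose 3 = 84"
     "(9::nat) choose 4 = 126" "(9::nat) choose 5 = 126" "(9::nat) choose 6 = 84"
    by (simp_all add: eval_nat_numeral)
  have "commutator a (b [^] (3::nat)) = u 3"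
    unfolding exp seven three by (simp add: u0 kill)
  then show "commutator a (b [^] (3::nat)) \<in> F (i + 3)" using u[of 3] by simp
  show "commutator a (b [^] (9::nat)) = \<one>"
    unfolding exp seven nine by (simp add: u0 kill)
qed

text \<open>Since \<open>k\<^sup>9\<close> commutes with \<open>x\<close>, the product is
\<open>x \<cdot> y \<cdot> x z\<^sup>2 \<cdot> x z \<cdot> y \<cdot> x z \<cdot> x z\<^sup>2 \<cdot> y \<cdot> x \<cdot> k\<^sup>3\<^sup>6\<close> with \<open>y = k\<^sup>-\<^sup>1 x k\<close> and \<open>z = [x\<^sup>-\<^sup>1, k\<^sup>3]\<close>. The
element \<open>z\<close> lies as deep as \<open>F 4\<close>, so each pair of neighbouring \<open>z\<close>'s collapses, by \<open>z\<^sup>3 = 1\<close>, to a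
power of an element \<open>e\<close> of \<open>F 5\<close>, and these powers add up to \<open>e\<^sup>3 = 1\<close>. What remains is the
conjugate by \<open>x\<close> of \<open>(y x\<^sup>2)\<^sup>3\<close>, followed by \<open>k\<^sup>3\<^sup>6\<close>, and \<open>y x\<^sup>2 = c x\<^sup>3\<close> has cube \<open>x\<^sup>9\<close>.\<close>

lemma witness_product_nine:
  assumes triv: "F 7 = {\<one>}" and cube: "\<And>u. u \<in> F 2 \<Longrightarrow> u [^] (3::nat) = \<one>"
    and x: "x \<in> F 1" and k: "k \<in> F 1"
  shows "k [^] (9::nat) \<otimes> x = x \<otimes> k [^] (9::nat)"
    and "witness_product x k 9 = x [^] (9::nat) \<otimes> k [^] (36::nat)"
proof -
  have cubes: "commutator a (b [^] (3::nat)) \<in> F (i + 3)" "commutator a (b [^] (9::nat)) = \<one>"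
    if "a \<in> F i" "i \<ge> 1" "b \<in> F 1" for a b i
    using commutator_power_cube_exponent[OF triv cube] that by blast+
  note [simp] = F_carrier[OF x] F_carrier[OF k]
  have commute: "a \<otimes> b = b \<otimes> a" if "commutator a b \<in> F i" "i \<ge> 7" "a \<in> carrier G" "b \<in> carrier G"
    for a b i
    using that F_trivial[OF triv] by (intro commutator_eq_one_commute) auto
  have F2: "u \<in> F 2" if "u \<in> F i" "i \<ge> 2" for u i
    using that F_antimono[of 2 i] by auto
  note inv_F = subgroup.m_inv_closed[OF subgroup_F]
  \<comment> \<open>Up to powers of \<open>k\<^sup>9\<close>, the nine conjugates of \<open>x\<close> in the product are \<open>x\<close>, \<open>y = c x\<close>,
    \<open>x z\<close> and \<open>x z\<^sup>2\<close>; the elements \<open>e\<close> and \<open>g\<close> measure how \<open>z\<close> and \<open>c\<close> fail to commute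
    with \<open>x\<close> and \<open>w = x\<^sup>3\<close>.\<close>
  define y c z e w g where "y = inv k \<otimes> x \<otimes> k" and "c = commutator (inv k) x"
    and "z = commutator (inv x) (k [^] (3::nat))" and "e = commutator (inv z) (inv x)"
    and "w = x [^] (3::nat)" and "g = commutator (inv c) w"
  have c: "c \<in> F 2" using commutator_F[OF inv_F[OF k] x] by (simp add: c_def numeral_eq_Suc)
  have z: "z \<in> F 4" using cubes(1)[OF inv_F[OF x] _ k] by (simp add: z_def)
  have e: "e \<in> F 5" using commutator_F[OF inv_F[OF z] inv_F[OF x]] by (simp add: e_def)
  have g: "g \<in> F 5" using cubes(1)[OF inv_F[OF c] _ x] by (simp add: g_def w_def)
  note [simp] = F_carrier[OF c] F_carrier[OF z] F_carrier[OF e] F_carrier[OF g]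
  have [simp]: "y \<in> carrier G" "w \<in> carrier G" by (simp_all add: y_def w_def)
  have "commutator x (k [^] (9::nat)) = \<one>" by (rule cubes(2)[OF x _ k]) simp_all
  then have "x \<otimes> k [^] (9::nat) = k [^] (9::nat) \<otimes> x" by (intro commutator_eq_one_commute) simp_all
  then show k9: "k [^] (9::nat) \<otimes> x = x \<otimes> k [^] (9::nat)" by simp

  have q0: "k [^] (9 * q) \<otimes> x = x \<otimes> k [^] (9 * q)" for q :: nat
  proof (induction q)
    case (Suc q)
    have "k [^] (9 * Suc q) = k [^] (9 * q) \<otimes> k [^] (9::nat)" by (simp add: nat_pow_mult add.commute)
    then show ?case
      using Suc.IH by (simp add: m_assoc k9 assoc_rewrite[OF Suc.IH])
  qed simp
  have k3x: "k [^] (3::nat) \<otimes> x = x \<otimes> z \<otimes> k [^] (3::nat)"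
    by (simp add: z_def commutator_def word_simps del: nat_pow_Suc)
  have "commutator z (k [^] (3::nat)) \<in> F 7" using cubes(1)[OF z _ k] by simp
  then have k3z: "k [^] (3::nat) \<otimes> z = z \<otimes> k [^] (3::nat)" by (rule commute[symmetric]) simp_all
  have k6x: "k [^] (6::nat) \<otimes> x = x \<otimes> z \<otimes> z \<otimes> k [^] (6::nat)"
  proof -
    have k6: "k [^] (6::nat) = k [^] (3::nat) \<otimes> k [^] (3::nat)" by (simp add: nat_pow_mult)
    show ?thesis
      unfolding k6 by (simp add: m_assoc k3x assoc_rewrite[OF k3x] k3z assoc_rewrite[OF k3z])
  qed
  have k8x: "k [^] (8::nat) \<otimes> x = y \<otimes> k [^] (8::nat)"
  proof -
    have "k [^] (9::nat) = k [^] (8::nat) \<otimes> k" by (simp add: numeral_eq_Suc)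
    then have k8: "k [^] (8::nat) = k [^] (9::nat) \<otimes> inv k" by (simp add: word_simps)
    have "k [^] (9::nat) = k \<otimes> k [^] (8::nat)" using nat_pow_Suc2[of k 8] by (simp add: numeral_eq_Suc)
    then have k8': "k [^] (8::nat) = inv k \<otimes> k [^] (9::nat)" by (simp add: word_simps)
    have "k [^] (8::nat) \<otimes> x = inv k \<otimes> (x \<otimes> k [^] (9::nat))"
      unfolding k8' by (simp add: m_assoc k9)
    also have "x \<otimes> k [^] (9::nat) = x \<otimes> (k \<otimes> k [^] (8::nat))" using k8' by (simp add: word_simps)
    finally show ?thesis by (simp add: y_def m_assoc)
  qed
  have shift: "k [^] (r + 9 * q) \<otimes> x = v \<otimes> k [^] (r + 9 * q)"
    if "k [^] r \<otimes> x = v \<otimes> k [^] r" "v \<in> carrier G" for r q :: nat and v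
  proof -
    have "k [^] (r + 9 * q) = k [^] r \<otimes> k [^] (9 * q)" by (simp add: nat_pow_mult)
    then show ?thesis using that by (simp add: m_assoc q0 assoc_rewrite[OF that(1)])
  qed
  \<comment> \<open>Pushing the powers of \<open>k\<close> to the right, factor by factor: the exponent collected so far
    runs through \<open>8, 15, 21, 26, 30, 33, 35, 36\<close>, and only its residue modulo 9 matters.\<close>
  have step: "k [^] s \<otimes> witness_product x k (Suc i) = v \<otimes> (k [^] (s + i) \<otimes> witness_product x k i)"
    if "k [^] s \<otimes> x = v \<otimes> k [^] s" "v \<in> carrier G" for s i v
    using that by (simp add: m_assoc assoc_rewrite[OF that(1)] nat_pow_mult[symmetric])
  have "witness_product x k 9 = x \<otimes> (k [^] (8::nat) \<otimes> witness_product x k 8)"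
    using step[of 0 x 8] by simp
  also have "k [^] (8::nat) \<otimes> witness_product x k 8 = y \<otimes> (k [^] (15::nat) \<otimes> witness_product x k 7)"
    using step[of 8 y 7] k8x by simp
  also have "k [^] (15::nat) \<otimes> witness_product x k 7 = (x \<otimes> z \<otimes> z) \<otimes> (k [^] (21::nat) \<otimes> witness_product x k 6)"
    using step[of 15 "x \<otimes> z \<otimes> z" 6] shift[OF k6x, of 1] by simp
  also have "k [^] (21::nat) \<otimes> witness_product x k 6 = (x \<otimes> z) \<otimes> (k [^] (26::nat) \<otimes> witness_product x k 5)"
    using step[of 21 "x \<otimes> z" 5] shift[OF k3x, of 2] by simp
  also have "k [^] (26::nat) \<otimes> witness_product x k 5 = y \<otimes> (k [^] (30::nat) \<otimes> witness_product x k 4)"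
    using step[of 26 y 4] shift[OF k8x, of 2] by simp
  also have "k [^] (30::nat) \<otimes> witness_product x k 4 = (x \<otimes> z) \<otimes> (k [^] (33::nat) \<otimes> witness_product x k 3)"
    using step[of 30 "x \<otimes> z" 3] shift[OF k3x, of 3] by simp
  also have "k [^] (33::nat) \<otimes> witness_product x k 3 = (x \<otimes> z \<otimes> z) \<otimes> (k [^] (35::nat) \<otimes> witness_product x k 2)"
    using step[of 33 "x \<otimes> z \<otimes> z" 2] shift[OF k6x, of 3] by simp
  also have "k [^] (35::nat) \<otimes> witness_product x k 2 = y \<otimes> (k [^] (36::nat) \<otimes> witness_product x k 1)"
    using step[of 35 y 1] shift[OF k8x, of 3] by (simp add: numeral_2_eq_2)
  also have "k [^] (36::nat) \<otimes> witness_product x k 1 = x \<otimes> k [^] (36::nat)"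
    using step[of 36 x 0] q0[of 4] by simp
  finally have U: "witness_product x k 9 = x \<otimes> (y \<otimes> ((x \<otimes> z \<otimes> z) \<otimes> ((x \<otimes> z) \<otimes>
      (y \<otimes> ((x \<otimes> z) \<otimes> ((x \<otimes> z \<otimes> z) \<otimes> (y \<otimes> (x \<otimes> k [^] (36::nat)))))))))" .

  have cube': "u \<otimes> (u \<otimes> u) = \<one>" if "u \<in> F i" "i \<ge> 2" for u i
    using cube[OF F2[OF that]] F_carrier[OF that(1)] by (simp add: numeral_eq_Suc m_assoc)
  have cube'': "u \<otimes> (u \<otimes> (u \<otimes> t)) = t" if "u \<in> F i" "i \<ge> 2" "t \<in> carrier G" for u i t
  proof -
    have "u \<otimes> (u \<otimes> (u \<otimes> t)) = (u \<otimes> (u \<otimes> u)) \<otimes> t" using F_carrier[OF that(1)] that(3) by (simp add: m_assoc)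
    then show ?thesis using cube'[OF that(1,2)] that(3) by simp
  qed
  have zx: "z \<otimes> x = x \<otimes> (z \<otimes> e)" by (simp add: e_def commutator_def word_simps)
  have ez: "e \<otimes> z = z \<otimes> e" by (rule commute[OF commutator_F[OF e z]]) simp_all
  have ec: "e \<otimes> c = c \<otimes> e" by (rule commute[OF commutator_F[OF e c]]) simp_all
  have eX: "e \<otimes> w = w \<otimes> e" by (rule commute[OF cubes(1)[OF e _ x], folded w_def]) simp_all
  have gc: "g \<otimes> c = c \<otimes> g" by (rule commute[OF commutator_F[OF g c]]) simp_all
  have gX: "w \<otimes> g = g \<otimes> w" by (rule commute[OF cubes(1)[OF g _ x], folded w_def, symmetric]) simp_all
  have Xc: "w \<otimes> c = c \<otimes> (g \<otimes> w)" by (simp add: g_def commutator_def word_simps)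
  note cubez = cube'[OF z] cube''[OF z] and cubee = cube'[OF e] cube''[OF e]
    and cubec = cube'[OF c] cube''[OF c] and cubeg = cube'[OF g] cube''[OF g]

  have p1: "(x \<otimes> z \<otimes> z) \<otimes> (x \<otimes> z) = x \<otimes> (x \<otimes> (e \<otimes> e))"
    by (simp add: m_assoc zx assoc_rewrite[OF zx] ez assoc_rewrite[OF ez] cubez)
  have p2: "(x \<otimes> z) \<otimes> (x \<otimes> z \<otimes> z) = x \<otimes> (x \<otimes> e)"
    by (simp add: m_assoc zx assoc_rewrite[OF zx] ez assoc_rewrite[OF ez] cubez)
  have q1: "(x \<otimes> z \<otimes> z) \<otimes> ((x \<otimes> z) \<otimes> t) = x \<otimes> (x \<otimes> (e \<otimes> (e \<otimes> t)))" if "t \<in> carrier G" for t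
    using that by (subst assoc_rewrite[OF p1]) (simp_all add: m_assoc)
  have q2: "(x \<otimes> z) \<otimes> ((x \<otimes> z \<otimes> z) \<otimes> t) = x \<otimes> (x \<otimes> (e \<otimes> t))" if "t \<in> carrier G" for t
    using that by (subst assoc_rewrite[OF p2]) (simp_all add: m_assoc)
  \<comment> \<open>The powers \<open>e\<^sup>2\<close> and \<open>e\<close> left over by the two pairs of factors pass through \<open>D\<close> and meet in \<open>e\<^sup>3 = 1\<close>.\<close>
  define D where "D = c \<otimes> w"
  have [simp]: "D \<in> carrier G" by (simp add: D_def)
  have yxx: "y \<otimes> (x \<otimes> x) = D"
    by (simp add: D_def y_def c_def w_def commutator_def numeral_eq_Suc word_simps)
  have eD: "e \<otimes> D = D \<otimes> e"
    by (simp add: D_def m_assoc ec assoc_rewrite[OF ec] eX)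
  have DDD: "D \<otimes> (D \<otimes> D) = w \<otimes> (w \<otimes> w)"
    by (simp add: D_def m_assoc Xc assoc_rewrite[OF Xc] gX assoc_rewrite[OF gX]
        gc assoc_rewrite[OF gc] cubec cubeg)
  have yx: "y \<otimes> x = D \<otimes> inv x" using yxx by (simp add: word_simps flip: yxx)
  have "witness_product x k 9 = x \<otimes> ((y \<otimes> (x \<otimes> x)) \<otimes> (e \<otimes> (e \<otimes>
      ((y \<otimes> (x \<otimes> x)) \<otimes> (e \<otimes> ((y \<otimes> x) \<otimes> k [^] (36::nat)))))))"
    unfolding U by (subst q1, simp, subst q2, simp, simp add: m_assoc)
  also have "\<dots> = x \<otimes> ((D \<otimes> (D \<otimes> D)) \<otimes> (inv x \<otimes> k [^] (36::nat)))"
    unfolding yxx yx by (simp add: m_assoc eD assoc_rewrite[OF eD] cubee)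
  also have "\<dots> = x [^] (9::nat) \<otimes> k [^] (36::nat)"
  proof -
    have X3: "w \<otimes> (w \<otimes> w) = x [^] (9::nat)" by (simp add: w_def nat_pow_mult)
    have "x \<otimes> x [^] (9::nat) = x [^] (9::nat) \<otimes> x"
      using nat_pow_comm[of x 1 9] by (simp del: nat_pow_Suc)
    note x9 = assoc_rewrite[OF this]
    show ?thesis unfolding DDD X3 by (subst x9) (simp_all add: word_simps)
  qed
  finally show "witness_product x k 9 = x [^] (9::nat) \<otimes> k [^] (36::nat)" .
qed

end

context group
begin

text \<open>For a group generated by \<open>x\<close> and \<open>k\<close>, the subgroup \<open>\<gamma>\<^sub>2\<close> is generated by \<open>\<gamma>\<^sub>3\<close> and the single element
\<open>[x, k]\<close>, which commutes with itself; so commutators of its elements lie in \<open>\<gamma>\<^sub>5\<close>, which contains \<open>[\<gamma>\<^sub>2, \<gamma>\<^sub>3]\<close>, and not just in \<open>\<gamma>\<^sub>4\<close>.\<close>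

lemma two_generated_commutator_lower_central_2:
  assumes gen: "carrier G = generate G {x, k}" and x: "x \<in> carrier G" and k: "k \<in> carrier G"
    and u: "u \<in> lower_central G 2" and v: "v \<in> lower_central G 2"
  shows "commutator u v \<in> lower_central G 5"
proof -
  define c where "c = commutator x k"
  let ?S = "insert c (lower_central G 3)"
  let ?L = "generate G ?S"
  have c: "c \<in> lower_central G 2"
    using commutator_lower_central_carrier[of x 1 k] x k by (simp add: c_def numeral_2_eq_2)
  have S2: "?S \<subseteq> lower_central G 2" using c lower_central_antimono[of 2 3] by simp
  have S: "?S \<subseteq> carrier G" using S2 lower_central_carrier by blast
  have sub: "subgroup ?L G" by (rule generate_is_subgroup[OF S])
  have L: "?L \<lhd> G"
    by (rule normal_subset_lower_central[OF sub, of 2])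
      (use S2 in \<open>auto simp: numeral_3_eq_3[symmetric] numeral_2_eq_2[symmetric] intro: generate.incl
        generate_subgroup_incl[OF S2 subgroup_lower_central, THEN subsetD]\<close>)
  have cL: "commutator x k \<in> ?L" unfolding c_def[symmetric] by (simp add: generate.incl)
  then have cL': "commutator k x \<in> ?L" by (rule commutator_in_subgroup_sym[OF sub x k])
  have xk: "{x, k} \<subseteq> carrier G" using x k by simp
  have base: "commutator a b \<in> ?L" if "a \<in> {x, k}" "b \<in> {x, k}" for a b
    using that cL cL' x k subgroup.one_closed[OF sub] by auto
  have "commutator a b \<in> ?L" if "a \<in> carrier G" "b \<in> carrier G" for a b
    using commutator_in_normal_generate[OF L xk xk base] that gen by simp
  then have "(\<Union>h\<in>lower_central G (Suc 0). \<Union>k\<in>carrier G. {commutator h k}) \<subseteq> ?L" by auto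
  from generate_subgroup_incl[OF this sub] have "lower_central G 2 \<subseteq> ?L"
    by (simp only: numeral_2_eq_2 lower_central_Suc)
  then have uv: "u \<in> ?L" "v \<in> ?L" using u v by auto
  note N5 = normal_lower_central[of 5]
  have base5: "commutator a b \<in> lower_central G 5" if "a \<in> ?S" "b \<in> ?S" for a b
  proof -
    have sum: "commutator a b \<in> lower_central G 5"
      if "a \<in> lower_central G i" "b \<in> lower_central G j" "5 \<le> i + j" for i j
      using commutator_lower_central[OF that(1,2)] lower_central_antimono[OF that(3)] by blast
    have "a = c \<and> b = c \<or> a \<in> lower_central G 3 \<or> b \<in> lower_central G 3" using that by auto
    then show ?thesis
    proof (elim disjE)
      assume "a = c \<and> b = c"
      then show ?thesis
        using lower_central_carrier[OF c] subgroup.one_closed[OF subgroup_lower_central] by simp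
    next
      assume "a \<in> lower_central G 3"
      moreover have "b \<in> lower_central G 2" using that(2) S2 by blast
      ultimately show ?thesis by (rule sum) simp
    next
      assume "b \<in> lower_central G 3"
      moreover have "a \<in> lower_central G 2" using that(1) S2 by blast
      ultimately show ?thesis using sum[of 2 3] by simp
    qed
  qed
  show ?thesis by (rule commutator_in_normal_generate[OF N5 S S base5 uv])
qed

text \<open>In class two, \<open>y\<^sup>3 w\<^sup>3 = (y w)\<^sup>3 [y, w]\<^sup>3\<close>, and the commutator can be moved inside the cube.\<close>

lemma normal_cubes:
  assumes N: "N \<lhd> G"
    and class2: "\<And>u v w. \<lbrakk>u \<in> N; v \<in> N; w \<in> N\<rbrakk> \<Longrightarrow> commutator (commutator u v) w = \<one>"
  shows "(\<lambda>y. y [^] (3::nat)) ` N \<lhd> G"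
proof -
  interpret N: normal N G by (rule N)
  let ?K = "(\<lambda>y. y [^] (3::nat)) ` N"
  have mult: "y [^] (3::nat) \<otimes> w [^] (3::nat) = (y \<otimes> w \<otimes> commutator y w) [^] (3::nat)"
    if y: "y \<in> N" and w: "w \<in> N" for y w
  proof -
    define t s where "t = commutator y w" and "s = commutator w y"
    have [simp]: "y \<in> carrier G" "w \<in> carrier G" "t \<in> carrier G" "s \<in> carrier G"
      using y w by (simp_all add: t_def s_def)
    have "t \<otimes> y = y \<otimes> t" "t \<otimes> w = w \<otimes> t" "s \<otimes> y = y \<otimes> s" "s \<otimes> w = w \<otimes> s"
      unfolding t_def s_def using y w by (intro commutator_eq_one_commute class2; simp)+
    note c = this this[THEN assoc_rewrite]
    have "inv t = s" by (simp add: t_def s_def inv_commutator)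
    then have st: "s \<otimes> t = \<one>" "t \<otimes> s = \<one>" using l_inv[of t] r_inv[of t] by simp_all
    have wy: "w \<otimes> y = y \<otimes> (w \<otimes> s)"
    proof -
      have "w \<otimes> y = s \<otimes> (y \<otimes> w)" by (simp add: s_def commutator_def word_simps)
      then show ?thesis by (simp add: m_assoc c)
    qed
    note st' = st[THEN assoc_rewrite]
    show ?thesis
      unfolding t_def[symmetric]
      by (simp add: numeral_eq_Suc m_assoc c wy assoc_rewrite[OF wy] st st')
  qed
  have comm_N: "commutator y w \<in> N" if "y \<in> N" "w \<in> N" for y w
    using normal_commutator_closed(1)[OF N that(1)] that(2) by simp
  have "subgroup ?K G"
  proof (rule subgroupI)
    show "?K \<subseteq> carrier G" by auto
    show "?K \<noteq> {}" using N.one_closed by blast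
    show "inv u \<in> ?K" if u: "u \<in> ?K" for u
    proof -
      obtain y where y: "y \<in> N" "u = y [^] (3::nat)" using u by (rule imageE) simp
      then have "inv u = (inv y) [^] (3::nat)" by (simp add: nat_pow_inv del: nat_pow_Suc)
      then show ?thesis using N.m_inv_closed[OF y(1)] by (rule image_eqI)
    qed
    show "u \<otimes> v \<in> ?K" if u: "u \<in> ?K" and v: "v \<in> ?K" for u v
    proof -
      obtain y where y: "y \<in> N" "u = y [^] (3::nat)" using u by (rule imageE) simp
      obtain w where w: "w \<in> N" "v = w [^] (3::nat)" using v by (rule imageE) simp
      have "y \<otimes> w \<otimes> commutator y w \<in> N"
        by (intro N.m_closed y(1) w(1) comm_N)
      then show ?thesis unfolding y(2) w(2) mult[OF y(1) w(1)] by (rule imageI)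
    qed
  qed
  moreover have "g \<otimes> u \<otimes> inv g \<in> ?K" if u: "u \<in> ?K" and g: "g \<in> carrier G" for u g
  proof -
    obtain y where y: "y \<in> N" "u = y [^] (3::nat)" using u by (rule imageE) simp
    have "g \<otimes> u \<otimes> inv g = (g \<otimes> y \<otimes> inv g) [^] (3::nat)"
      unfolding y(2) using y(1) g by (simp add: conj_nat_pow)
    then show ?thesis using N.inv_op_closed2[OF g y(1)] by (rule image_eqI)
  qed
  ultimately show ?thesis by (simp add: normal_inv_iff)
qed

text \<open>Modulo the cubes of \<open>\<gamma>\<^sub>2\<close> all coefficients with index 3 to 8 disappear from the expansion of \<open>P(9)\<close>,
because 3 divides \<open>C(9,j)\<close>. What is left is \<open>x\<^sup>9 (x\<^sup>-\<^sup>1 k x)\<^sup>3\<^sup>6 a\<^sub>9\<close>, to be compared with the direct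
evaluation \<open>x\<^sup>9 k\<^sup>3\<^sup>6\<close>.\<close>

lemma ninth_coefficient_is_cube:
  assumes gen: "carrier G = generate G {x, k}" and x: "x \<in> carrier G" and k: "k \<in> carrier G"
    and triv: "lower_central G 7 = {\<one>}"
    and a: "\<And>j. a j \<in> carrier G" "\<And>j. j \<ge> 3 \<Longrightarrow> a j \<in> lower_central G 2"
    and a012: "a 0 = \<one>" "a 1 = x" "a 2 = inv x \<otimes> k \<otimes> x"
    and nine: "witness_product x k 9 = binomial_product a 9 13"
  shows "\<exists>y \<in> lower_central G 2. a 9 = y [^] (3::nat)"
proof -
  define N where "N = lower_central G 2"
  define K where "K = (\<lambda>y. y [^] (3::nat)) ` N"
  have "commutator (commutator u v) w = \<one>" if "u \<in> N" "v \<in> N" "w \<in> N" for u v w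
    using commutator_lower_central[OF two_generated_commutator_lower_central_2[OF gen x k] that(3)[unfolded N_def]]
      that triv by (simp add: N_def)
  then have K: "K \<lhd> G" unfolding K_def N_def by (intro normal_cubes normal_lower_central)
  interpret K: normal K G by (rule K)
  define \<phi> where "\<phi> = (\<lambda>g. K #> g)"
  interpret Q: group_hom G "G Mod K" \<phi>
    unfolding \<phi>_def using K.factorgroup_is_group K.r_coset_hom_Mod
    by (intro group_hom.intro group_hom_axioms.intro is_group)
  interpret F: filtered_group "G Mod K" "\<lambda>i. \<phi> ` lower_central G i"
    by (rule Q.filtered_group_image[OF filtered_group_lower_central])
  have kernel: "\<phi> g = \<one>\<^bsub>G Mod K\<^esub> \<longleftrightarrow> g \<in> K" if "g \<in> carrier G" for g
    using that K.rcos_const[OF is_group] coset_join1[of K g] K.subset K.subgroup_axioms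
    by (auto simp: \<phi>_def FactGroup_def)
  have cube: "u [^]\<^bsub>G Mod K\<^esub> (3::nat) = \<one>\<^bsub>G Mod K\<^esub>" if u: "u \<in> \<phi> ` lower_central G 2" for u
  proof -
    obtain y where y: "y \<in> N" "u = \<phi> y" using u by (auto simp: N_def)
    then have yc: "y \<in> carrier G" using lower_central_carrier by (auto simp: N_def)
    have "y [^] (3::nat) \<in> K" using y by (auto simp: K_def)
    then show ?thesis using kernel[of "y [^] (3::nat)"] yc y by (simp add: Q.hom_nat_pow)
  qed
  have triv': "\<phi> ` lower_central G 7 = {\<one>\<^bsub>G Mod K\<^esub>}" by (simp add: triv)
  have in1: "\<phi> g \<in> \<phi> ` lower_central G 1" if "g \<in> carrier G" for g using that by simp
  \<comment> \<open>These rewrite products of cosets to set products, which would hide the group structure of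
    the quotient.\<close>
  note [simp del] = mult_FactGroup one_FactGroup
  note Q9 = F.witness_product_nine[OF triv' cube in1[OF x] in1[OF k]]
  note [simp] = x k a(1)
  have "a 2 [^] (36::nat) = inv x \<otimes> k [^] (36::nat) \<otimes> x"
    using conj_nat_pow[of "inv x" k 36] by (simp add: a012)
  then have a2: "\<phi> (a 2) [^]\<^bsub>G Mod K\<^esub> (36::nat) =
      inv\<^bsub>G Mod K\<^esub> (\<phi> x) \<otimes>\<^bsub>G Mod K\<^esub> \<phi> k [^]\<^bsub>G Mod K\<^esub> (36::nat) \<otimes>\<^bsub>G Mod K\<^esub> \<phi> x"
    by (simp flip: Q.hom_nat_pow)
  have "(\<phi> k [^]\<^bsub>G Mod K\<^esub> (9::nat)) [^]\<^bsub>G Mod K\<^esub> (4::nat) \<otimes>\<^bsub>G Mod K\<^esub> \<phi> x =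
      \<phi> x \<otimes>\<^bsub>G Mod K\<^esub> (\<phi> k [^]\<^bsub>G Mod K\<^esub> (9::nat)) [^]\<^bsub>G Mod K\<^esub> (4::nat)"
    by (rule Q.H.group_commutes_pow[OF Q9(1)]) simp_all
  then have k36: "\<phi> (a 2) [^]\<^bsub>G Mod K\<^esub> (36::nat) = \<phi> k [^]\<^bsub>G Mod K\<^esub> (36::nat)"
    unfolding a2 by (simp add: Q.H.nat_pow_pow Q.H.word_simps)
  have choose: "(9::nat) choose 0 = 1" "(9::nat) choose 1 = 9" "(9::nat) choose 2 = 36"
     "(9::nat) choose 3 = 84" "(9::nat) choose 4 = 126" "(9::nat) choose 5 = 126"
     "(9::nat) choose 6 = 84" "(9::nat) choose 7 = 36" "(9::nat) choose 8 = 9"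
     "(9::nat) choose 9 = 1" "(9::nat) choose 10 = 0" "(9::nat) choose 11 = 0"
     "(9::nat) choose 12 = 0"
    by (simp_all add: eval_nat_numeral)
  have thirteen: "binomial_product a n 13 = a 0 [^] (n choose 0) \<otimes> a 1 [^] (n choose 1) \<otimes>
    a 2 [^] (n choose 2) \<otimes> a 3 [^] (n choose 3) \<otimes> a 4 [^] (n choose 4) \<otimes>
    a 5 [^] (n choose 5) \<otimes> a 6 [^] (n choose 6) \<otimes> a 7 [^] (n choose 7) \<otimes>
    a 8 [^] (n choose 8) \<otimes> a 9 [^] (n choose 9) \<otimes> a 10 [^] (n choose 10) \<otimes>
    a 11 [^] (n choose 11) \<otimes> a 12 [^] (n choose 12)" for n
    by (simp add: eval_nat_numeral del: binomial_Suc_Suc)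
  have kill: "\<phi> (a j) [^]\<^bsub>G Mod K\<^esub> n = \<one>\<^bsub>G Mod K\<^esub>" if "j \<ge> 3" "3 dvd n" for j and n :: nat
    using Q.H.pow_eq_one_dvd[OF _ cube that(2)] a(2)[OF that(1)] by simp
  have "\<phi> (binomial_product a 9 13) = \<phi> x [^]\<^bsub>G Mod K\<^esub> (9::nat) \<otimes>\<^bsub>G Mod K\<^esub>
      \<phi> k [^]\<^bsub>G Mod K\<^esub> (36::nat) \<otimes>\<^bsub>G Mod K\<^esub> \<phi> (a 9)"
    unfolding thirteen choose by (simp add: Q.hom_nat_pow kill k36 a012(1) a012(2)[simplified])
  moreover have "\<phi> (binomial_product a 9 13) = \<phi> x [^]\<^bsub>G Mod K\<^esub> (9::nat) \<otimes>\<^bsub>G Mod K\<^esub>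
      \<phi> k [^]\<^bsub>G Mod K\<^esub> (36::nat)"
    unfolding nine[symmetric] using Q9(2) by (simp add: Q.hom_witness_product)
  ultimately have "\<phi> (a 9) = \<one>\<^bsub>G Mod K\<^esub>" by simp
  then show ?thesis using kernel by (auto simp: K_def N_def)
qed

lemma witness_product_two_generated:
  assumes p: "Factorial_Ring.prime p" "p > 2"
    and gen: "carrier G = generate G {x, k}" and x: "x \<in> carrier G" and k: "k \<in> carrier G"
    and triv: "lower_central G 7 = {\<one>}"
    and exp: "\<And>g. g \<in> carrier G \<Longrightarrow> g [^] (p ^ Suc e) = \<one>"
    and exp': "\<And>u. u \<in> lower_central G 2 \<Longrightarrow> u [^] (p ^ e) = \<one>"
  shows "witness_product x k (p ^ Suc e) = \<one>"
proof -
  interpret F: filtered_group G "\<lambda>i. lower_central G ((i + 1) div 2)"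
    by (rule filtered_group_halved)
  obtain a where a: "\<And>j. a j \<in> lower_central G ((j + 1) div 2)"
    and a012: "a 0 = \<one>" "a 1 = x" "a 2 = inv x \<otimes> k \<otimes> x"
    and prod: "\<And>n. witness_product x k n = binomial_product a n 13"
    by (rule F.witness_product_expansion[of x k 13]) (use x k triv in auto)
  have ac: "a j \<in> carrier G" for j using a by (rule F.F_carrier)
  have a2: "a j \<in> lower_central G 2" if "3 \<le> j" for j
    using a[of j] F.F_antimono[OF that] by auto
  show ?thesis
    unfolding prod
  proof (rule prime_power_binomial_product_eq_one[where a = a, OF p ac exp a012(1)])
    show "a j [^] (p ^ e) = \<one>" if "3 \<le> j" for j by (rule exp'[OF a2[OF that]])
    show "a j [^] (p ^ Suc e choose j) = \<one>" if j: "3 \<le> j" "j < 13" "p\<^sup>2 dvd j" for j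
    proof -
      \<comment> \<open>The square of an odd prime divides an index below 13 only for \<open>p = 3\<close> and index 9.\<close>
      have "p\<^sup>2 \<le> j" using j by (intro dvd_imp_le) auto
      then have "p\<^sup>2 < 4\<^sup>2" using j by simp
      then have "p < 4" by (rule power_less_imp_less_base) simp
      then have p3: "p = 3" using p by simp
      then have "9 dvd j" using j(3) by simp
      then obtain q where "j = 9 * q" ..
      then have j9: "j = 9" using j(1,2) by simp
      obtain y where y: "y \<in> lower_central G 2" "a 9 = y [^] (3::nat)"
        using ninth_coefficient_is_cube[OF gen x k triv ac a2 a012 prod] by blast
      have yc: "y \<in> carrier G" using lower_central_carrier[OF y(1)] .
      have "a 9 [^] (3 ^ Suc e choose 9) = y [^] (3 * (3 ^ Suc e choose 9))"
        unfolding y(2) using yc by (rule nat_pow_pow)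
      also have "\<dots> = \<one>"
        by (rule pow_eq_one_dvd[OF yc exp'[OF y(1), unfolded p3] three_power_dvd_binomial_nine])
      finally show ?thesis unfolding j9 p3 .
    qed
  qed
qed

lemma
  assumes H: "subgroup H G"
  shows subgroup_witness_product: "group.witness_product (G\<lparr>carrier := H\<rparr>) a b n = witness_product a b n"
    and subgroup_lower_central_subset: "lower_central (G\<lparr>carrier := H\<rparr>) i \<subseteq> lower_central G i"
proof -
  interpret H: group "G\<lparr>carrier := H\<rparr>" by (rule subgroup_imp_group[OF H])
  have comm: "H.commutator a b = commutator a b" if "a \<in> H" "b \<in> H" for a b
    using that H by (simp add: commutator_def H.commutator_def m_inv_consistent)
  show "H.witness_product a b n = witness_product a b n"
    by (induction n) (simp_all add: nat_pow_consistent[symmetric])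
  show "lower_central (G\<lparr>carrier := H\<rparr>) i \<subseteq> lower_central G i"
  proof (induction i)
    case 0
    then show ?case using subgroup.subset[OF H] by simp
  next
    case (Suc i)
    show ?case
    proof (cases i)
      case 0
      then show ?thesis using subgroup.subset[OF H] by simp
    next
      case (Suc j)
      let ?S = "\<Union>h\<in>lower_central (G\<lparr>carrier := H\<rparr>) (Suc j). \<Union>k\<in>H. {H.commutator h k}"
      have sub: "lower_central (G\<lparr>carrier := H\<rparr>) (Suc j) \<subseteq> H" using H.lower_central_carrier by auto
      have "?S \<subseteq> H" using sub H.commutator_closed by auto
      then have "lower_central (G\<lparr>carrier := H\<rparr>) (Suc (Suc j)) = generate G ?S"
        using generate_consistent[OF _ H, of ?S] by (simp add: H.lower_central_Suc)
      also have "\<dots> \<subseteq> generate G (\<Union>h\<in>lower_central G (Suc j). \<Union>k\<in>carrier G. {commutator h k})"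
      proof (rule mono_generate)
        show "?S \<subseteq> (\<Union>h\<in>lower_central G (Suc j). \<Union>k\<in>carrier G. {commutator h k})"
        proof
          fix v assume "v \<in> ?S"
          then obtain h k where hk: "h \<in> lower_central (G\<lparr>carrier := H\<rparr>) (Suc j)" "k \<in> H"
            and "v = H.commutator h k" by blast
          then have "v = commutator h k" using comm sub by blast
          moreover have "h \<in> lower_central G (Suc j)" "k \<in> carrier G"
            using hk Suc.IH subgroup.subset[OF H] unfolding Suc by blast+
          ultimately show "v \<in> (\<Union>h\<in>lower_central G (Suc j). \<Union>k\<in>carrier G. {commutator h k})"
            by blast
        qed
      qed
      finally show ?thesis unfolding Suc lower_central_Suc .
    qed
  qed
qed

text \<open>Reduction to the subgroup generated by \<open>x\<close> and \<open>k\<close>, whose lower central series lies termwise in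
that of the whole group.\<close>

lemma witness_product_shallow:
  assumes p: "Factorial_Ring.prime p" "p > 2"
    and triv: "lower_central G 7 = {\<one>}"
    and exp: "\<And>g. g \<in> carrier G \<Longrightarrow> g [^] (p ^ Suc e) = \<one>"
    and exp': "\<And>u. u \<in> lower_central G 2 \<Longrightarrow> u [^] (p ^ e) = \<one>"
    and x: "x \<in> carrier G" and k: "k \<in> carrier G"
  shows "witness_product x k (p ^ Suc e) = \<one>"
proof -
  let ?H = "generate G {x, k}"
  have xk: "{x, k} \<subseteq> carrier G" using x k by simp
  have H: "subgroup ?H G" by (rule generate_is_subgroup[OF xk])
  interpret H: group "G\<lparr>carrier := ?H\<rparr>" by (rule subgroup_imp_group[OF H])
  note sub = subgroup_lower_central_subset[OF H]
  have xkH: "x \<in> ?H" "k \<in> ?H" by (simp_all add: generate.incl)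
  have "H.witness_product x k (p ^ Suc e) = \<one>\<^bsub>G\<lparr>carrier := ?H\<rparr>\<^esub>"
  proof (rule H.witness_product_two_generated[OF p])
    show "carrier (G\<lparr>carrier := ?H\<rparr>) = generate (G\<lparr>carrier := ?H\<rparr>) {x, k}"
      using generate_consistent[OF _ H, of "{x, k}"] xkH by simp
    show "lower_central (G\<lparr>carrier := ?H\<rparr>) 7 = {\<one>\<^bsub>G\<lparr>carrier := ?H\<rparr>\<^esub>}"
      using sub[of 7] triv subgroup.one_closed[OF H.subgroup_lower_central[of 7]] by auto
    show "g [^]\<^bsub>G\<lparr>carrier := ?H\<rparr>\<^esub> (p ^ Suc e) = \<one>\<^bsub>G\<lparr>carrier := ?H\<rparr>\<^esub>"
      if "g \<in> carrier (G\<lparr>carrier := ?H\<rparr>)" for g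
      using exp[of g] that subgroup.mem_carrier[OF H] by (simp flip: nat_pow_consistent)
    show "u [^]\<^bsub>G\<lparr>carrier := ?H\<rparr>\<^esub> (p ^ e) = \<one>\<^bsub>G\<lparr>carrier := ?H\<rparr>\<^esub>"
      if "u \<in> lower_central (G\<lparr>carrier := ?H\<rparr>) 2" for u
      using exp'[of u] that sub[of 2] by (auto simp flip: nat_pow_consistent)
  qed (use xkH in simp_all)
  then show ?thesis by (simp add: subgroup_witness_product[OF H])
qed

end

section \<open>From witnesses to J-groups\<close>

context group
begin

lemma witness_product_eq_foldr:
  "foldr (\<otimes>) (map (\<lambda>i. x \<otimes> k [^] (n - i)) [1..<Suc n]) \<one> = witness_product x k n"
proof -
  have *: "map (\<lambda>i. x \<otimes> k [^] (n - i)) [1..<Suc n] = rev (map (\<lambda>i. x \<otimes> k [^] i) [0..<n])" for n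
    by (intro nth_equalityI) (auto simp: rev_nth simp del: upt_Suc)
  show ?thesis
    unfolding * by (induction n) simp_all
qed

lemma witnesses_eq:
  "witnesses G = {k \<in> carrier G. ord k > 0 \<and> (\<forall>x \<in> carrier G. witness_product x k (ord k) = \<one>)}"
  unfolding witnesses_def witness_product_eq_foldr ..

text \<open>The function is \<open>f(r k\<^sup>j) = P(j)\<close>, formed with \<open>r\<close> in place of \<open>x\<close>, for chosen representatives \<open>r\<close> of the
cosets of the subgroup generated by \<open>k\<close>. It does not depend on \<open>j\<close> because \<open>P\<close> is periodic as
soon as \<open>P(n) = 1\<close>.\<close>

lemma J_group_if_witness:
  assumes "k \<in> witnesses G"
  shows "J_group G"
proof -
  define n where "n = ord k"
  have k: "k \<in> carrier G" and n: "n > 0"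
    and wit: "\<And>x. x \<in> carrier G \<Longrightarrow> witness_product x k n = \<one>"
    using assms by (auto simp: witnesses_eq n_def)
  have kn: "k [^] n = \<one>" using k by (simp add: n_def)
  have periodic: "witness_product x k (i + n * q) = witness_product x k i"
    if x: "x \<in> carrier G" for x i q
  proof (induction q)
    case (Suc q)
    have "witness_product x k (l + n) = witness_product x k l" for l
    proof (induction l)
      case 0
      then show ?case using wit[OF x] by simp
    next
      case (Suc l)
      have "k [^] (l + n) = k [^] l" using k kn by (simp flip: nat_pow_mult)
      then show ?case using Suc.IH by simp
    qed
    from this[of "i + n * q"] show ?case using Suc.IH by (simp add: ac_simps)
  qed simp
  have pow_eq: "witness_product x k i = witness_product x k j"
    if x: "x \<in> carrier G" and eq: "k [^] i = k [^] j" for x and i j :: nat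
  proof -
    have le: "witness_product x k i = witness_product x k j"
      if "i \<le> j" "k [^] j = k [^] i" for i j :: nat
    proof -
      have "n dvd j - i" using pow_eq_div2[OF k that(2)] pow_eq_id[OF k] by (simp add: n_def)
      then obtain q where "j - i = n * q" ..
      then have "j = i + n * q" using that(1) by simp
      then show ?thesis using periodic[OF x] by simp
    qed
    show ?thesis
    proof (cases "i \<le> j")
      case True
      then show ?thesis using eq[symmetric] by (rule le)
    next
      case False
      then show ?thesis using le[OF _ eq] by simp
    qed
  qed
  \<comment> \<open>The function is defined along the orbits of right multiplication by \<open>k\<close>; periodicity makes the
    choice of the exponent \<open>dist x\<close> irrelevant.\<close>
  define orbit where "orbit = (\<lambda>x. {x \<otimes> k [^] j | j :: nat. True})"
  define rep where "rep = (\<lambda>x. SOME r. r \<in> orbit x)"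
  define dist where "dist = (\<lambda>x. SOME j :: nat. x = rep x \<otimes> k [^] j)"
  define f where "f = (\<lambda>x. witness_product (rep x) k (dist x))"
  have orbit_mult: "orbit (x \<otimes> k) = orbit x" if x: "x \<in> carrier G" for x
  proof -
    have forward: "x \<otimes> k \<otimes> k [^] j = x \<otimes> k [^] Suc j" for j :: nat
      unfolding nat_pow_Suc2[OF k] using x k by (simp only: m_assoc nat_pow_closed)
    have backward: "x \<otimes> k [^] j = x \<otimes> k \<otimes> k [^] (j + (n - 1))" for j :: nat
    proof -
      have "k [^] Suc (j + (n - 1)) = k [^] j \<otimes> k [^] n" using n by (simp add: nat_pow_mult k)
      also have "\<dots> = k [^] j" using k kn by simp
      finally show ?thesis unfolding forward by simp
    qed
    show ?thesis
    proof (intro equalityI subsetI)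
      show "y \<in> orbit x" if "y \<in> orbit (x \<otimes> k)" for y
        using that forward unfolding orbit_def by blast
      fix y assume "y \<in> orbit x"
      then obtain j :: nat where "y = x \<otimes> k [^] j" unfolding orbit_def by blast
      then have "y = x \<otimes> k \<otimes> k [^] (j + (n - 1))" using backward[of j] by (rule trans)
      then show "y \<in> orbit (x \<otimes> k)" unfolding orbit_def by blast
    qed
  qed
  have rep_mult: "rep (x \<otimes> k) = rep x" if "x \<in> carrier G" for x
    using orbit_mult[OF that] by (simp add: rep_def)
  have rep: "rep x \<in> carrier G" and dist: "rep x \<otimes> k [^] dist x = x" if x: "x \<in> carrier G" for x
  proof -
    have "x \<otimes> k [^] (0::nat) \<in> orbit x" unfolding orbit_def by blast
    then have "rep x \<in> orbit x" unfolding rep_def by (rule someI)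
    then obtain j :: nat where j: "rep x = x \<otimes> k [^] j" unfolding orbit_def by blast
    then show "rep x \<in> carrier G" using x k by simp
    have "j + j * (n - 1) = n * j" using n by (cases n) simp_all
    then have "k [^] (j + j * (n - 1)) = \<one>" using k kn by (simp flip: nat_pow_pow)
    then have "x = rep x \<otimes> k [^] (j * (n - 1))" using x k by (simp add: j m_assoc nat_pow_mult)
    then have "x = rep x \<otimes> k [^] dist x" unfolding dist_def by (rule someI)
    then show "rep x \<otimes> k [^] dist x = x" by (rule sym)
  qed
  have "f (x \<otimes> k) = x \<otimes> f x" if x: "x \<in> carrier G" for x
  proof -
    have xk: "x \<otimes> k \<in> carrier G" using x k by simp
    have "rep x \<otimes> k [^] dist (x \<otimes> k) = x \<otimes> k" using dist[OF xk] rep_mult[OF x] by simp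
    also have "x \<otimes> k = rep x \<otimes> k [^] dist x \<otimes> k" using dist[OF x] by simp
    also have "\<dots> = rep x \<otimes> k [^] Suc (dist x)" using rep[OF x] k by (simp add: m_assoc)
    finally have "k [^] dist (x \<otimes> k) = k [^] Suc (dist x)" using rep[OF x] k by simp
    then have "f (x \<otimes> k) = witness_product (rep x) k (Suc (dist x))"
      unfolding f_def rep_mult[OF x] by (rule pow_eq[OF rep[OF x]])
    then show ?thesis using dist[OF x] by (simp add: f_def)
  qed
  moreover have "f \<in> carrier G \<rightarrow> carrier G" using rep k by (auto simp: f_def)
  ultimately show ?thesis unfolding J_group_def using k by blast
qed

end

section \<open>Exponents of the lower central series\<close>

context group
begin

lemma ord_subgroup:
  assumes "subgroup H G"
  shows "group.ord (G\<lparr>carrier := H\<rparr>) x = ord x"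
proof -
  interpret H: group "G\<lparr>carrier := H\<rparr>" by (rule subgroup_imp_group[OF assms])
  show ?thesis by (simp add: H.ord_def ord_def flip: nat_pow_consistent)
qed

lemma group_exponent_subgroup:
  "subgroup H G \<Longrightarrow> group_exponent (G\<lparr>carrier := H\<rparr>) = Lcm (ord ` H)"
  by (simp add: group_exponent_def ord_subgroup)

lemma pow_group_exponent: "x \<in> carrier G \<Longrightarrow> x [^] group_exponent G = \<one>"
  by (simp add: pow_eq_id group_exponent_def)

end

lemma dvd_prime_power_Suc_cases:
  fixes p i e :: nat
  assumes "Factorial_Ring.prime p" "i dvd p ^ Suc e" "i \<noteq> p ^ Suc e"
  shows "i dvd p ^ e"
proof -
  obtain l where l: "l \<le> Suc e" "i = p ^ l"
    using assms(1,2) by (auto simp only: divides_primepow_nat)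
  then have "l \<le> e" using assms(3) by (cases "l = Suc e") auto
  then show ?thesis using l by (simp add: le_imp_power_dvd)
qed

text \<open>If \<open>p ^ Suc e\<close> is the exponent of the group, maximality of \<open>d\<close> makes the exponent of \<open>\<gamma>\<^bsub>d+1\<^esub>\<close> a proper
divisor of it, hence a divisor of \<open>p ^ e\<close>; this is the factor \<open>p\<close> that the binomial coefficients may lose.\<close>

lemma (in group) max_order_elements_lower_central_witnesses:
  assumes "Factorial_Ring.prime p" and "p > 2"
    and "finite_p_group p G"
    and "has_nilpotency_class G c"
    and "last_full_exponent_index G d"
    and "c \<le> d + 5"
  shows "J_group G \<and> max_order_elements (lower_central_group G d) \<subseteq> witnesses G"
proof -
  note p = assms(1,2)
  obtain m where m: "order G = p ^ m" using assms(3) by (auto simp: finite_p_group_def)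
  note sub = subgroup_lower_central
  have maxord: "max_order_elements (lower_central_group G d) =
      {k \<in> lower_central G d. ord k = group_exponent (lower_central_group G d)}"
    by (simp add: max_order_elements_def ord_subgroup[OF sub])
  show ?thesis
  proof (cases "carrier G = {\<one>}")
    case True
    have "k \<in> witnesses G" if "k \<in> carrier G" for k
      using that True witness_product_closed[of _ k "ord k"] by (auto simp: witnesses_eq)
    then have "max_order_elements (lower_central_group G d) \<subseteq> witnesses G" "\<one> \<in> witnesses G"
      using lower_central_carrier by (auto simp: maxord)
    then show ?thesis using J_group_if_witness by blast
  next
    case False
    have d: "d \<ge> 1" and full: "group_exponent (lower_central_group G d) = group_exponent G"
      and notfull: "group_exponent (lower_central_group G (Suc d)) \<noteq> group_exponent G"
      using assms(5) False by (auto simp: last_full_exponent_index_def)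
    have "ord g dvd p ^ m" if "g \<in> carrier G" for g
      using pow_order_eq_1[OF that] pow_eq_id[OF that] m by simp
    then have "group_exponent G dvd p ^ m" by (auto simp: group_exponent_def intro!: Lcm_least)
    then obtain f where f: "group_exponent G = p ^ f"
      using p(1) by (auto simp only: divides_primepow_nat)
    have "f \<noteq> 0"
    proof
      assume "f = 0"
      then have "g = \<one>" if "g \<in> carrier G" for g
        using pow_group_exponent[OF that] that f by simp
      then show False using False by auto
    qed
    then obtain e where n: "group_exponent G = p ^ Suc e" using f by (cases f) auto
    have exp: "g [^] (p ^ Suc e) = \<one>" if "g \<in> carrier G" for g
      using pow_group_exponent[OF that] n by simp
    then have ord_dvd: "ord g dvd p ^ Suc e" if "g \<in> carrier G" for g
      using that pow_eq_id by blast
    have exp': "u [^] (p ^ e) = \<one>" if u: "u \<in> lower_central G (Suc d)" for u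
    proof -
      let ?E = "Lcm (ord ` lower_central G (Suc d))"
      have "?E dvd p ^ Suc e" using ord_dvd lower_central_carrier by (intro Lcm_least) auto
      moreover have "?E \<noteq> p ^ Suc e" using notfull n by (simp add: group_exponent_subgroup[OF sub])
      ultimately have "?E dvd p ^ e" by (rule dvd_prime_power_Suc_cases[OF p(1)])
      moreover have "ord u dvd ?E" using u by (intro dvd_Lcm) simp
      ultimately have "ord u dvd p ^ e" by (rule dvd_trans[rotated])
      then show ?thesis using pow_eq_id[OF lower_central_carrier[OF u]] by simp
    qed
    have "lower_central G (d + 6) \<subseteq> lower_central G (c + 1)"
      using assms(6) by (intro lower_central_antimono) linarith
    then have triv: "lower_central G (d + 6) = {\<one>}"
      using assms(4) subgroup.one_closed[OF sub, of "d + 6"] by (auto simp: has_nilpotency_class_def)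
    have wit: "k \<in> witnesses G" if k: "k \<in> lower_central G d" and ord: "ord k = p ^ Suc e" for k
    proof -
      have kc: "k \<in> carrier G" using lower_central_carrier[OF k] .
      have "witness_product x k (p ^ Suc e) = \<one>" if x: "x \<in> carrier G" for x
      proof (cases "d = 1")
        case True
        then show ?thesis
          using triv exp' by (intro witness_product_shallow[OF p _ exp _ x kc]) (simp_all add: numeral_2_eq_2)
      next
        case False
        then show ?thesis
          using d by (intro witness_product_deep[OF p _ triv exp exp' x k]) simp_all
      qed
      moreover have "p ^ Suc e > 0" using p by simp
      ultimately show ?thesis using kc ord by (simp add: witnesses_eq)
    qed
    \<comment> \<open>All orders divide \<open>p ^ Suc e\<close>, so their least common multiple is attained.\<close>
    have "\<exists>k \<in> lower_central G d. ord k = p ^ Suc e"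
    proof (rule ccontr)
      assume none: "\<not> ?thesis"
      have "ord g dvd p ^ e" if "g \<in> lower_central G d" for g
        using none that
        by (intro dvd_prime_power_Suc_cases[OF p(1) ord_dvd[OF lower_central_carrier[OF that]]]) blast
      then have "Lcm (ord ` lower_central G d) dvd p ^ e" by (intro Lcm_least) auto
      then have "p ^ Suc e dvd p ^ e" using full n by (simp add: group_exponent_subgroup[OF sub])
      then show False using p by (simp add: power_dvd_imp_le dvd_power_iff)
    qed
    then have "J_group G" using wit J_group_if_witness by blast
    moreover have "max_order_elements (lower_central_group G d) \<subseteq> witnesses G"
      using wit full n by (auto simp: maxord)
    ultimately show ?thesis ..
  qed
qed

theorem theorem4p10:
  fixes G :: "('a, 'b) monoid_scheme" and p c d :: nat
  assumes "Factorial_Ring.prime p" and "p > 2"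
    and "finite_p_group p G"
    and "has_nilpotency_class G c"
    and "last_full_exponent_index G d"
    and "int d \<ge> int c - 5"
  shows "J_group G \<and> max_order_elements (lower_central_group G d) \<subseteq> witnesses G"
proof -
  interpret group G using assms(3) by (simp add: finite_p_group_def)
  have "c \<le> d + 5" using assms(6) by linarith
  with assms(1-5) show ?thesis by (rule max_order_elements_lower_central_witnesses)
qed

end
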